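(* Let $\mathbb{K}$ be an infinite field, let $q \ge 2$, and let $X \subset (\mathbb{P}^1)^q$ be a zero-dimensional subscheme over $\mathbb{K}$. Assume that $I(X)$ is a monomial ideal and that $X$ is not a complete intersection. Let $g_1, \dots, g_n$, $R(X)$ and $R_1, \dots, R_n$ be as defined in the context. Then the quasi-rectangular domain $$D(X) = R(X) \setminus \bigcup_{1 \le l \le n} R_l \subset \mathbb{Z}^q$$ is a relevant domain for $\mathcal{H}_X$. If $I(X)$ has $q+1$ minimal generators, then $D(X)$ is strictly contained in $R(X)$.
   Context: The coordinate ring of $(\mathbb{P}^1)^q$ is $\mathbb{S} = \mathbb{K}[x_1, y_1, \dots, x_q, y_q]$, $\mathbb{Z}^q$-graded by $\deg(x_i) = \deg(y_i) = e_i$, the $i$-th standard basis element of $\mathbb{Z}^q$. $I(X) \subset \mathbb{S}$ is the ideal generated by the $\mathbb{Z}^q$-homogeneous forms vanishing on $X$, and $\mathcal{H}_X(a) = \dim_{\mathbb{K}} (\mathbb{S}/I(X))_a$ for $a \in \mathbb{Z}^q$. Partial order on $\mathbb{Z}^q$: $a \le b$ iff $a_i \le b_i$ for all $i$; $[r,s] = \{a \in \mathbb{Z}^q \mid r \le a \le s\}$ (empty if $r \nleq s$); $\mathbb{Z}_+^q = \{a \ge 0\}$. For $\mathcal{F}\colon \mathbb{Z}^q \to \mathbb{Z}$, $$\Delta \mathcal{F}(a) = \mathcal{F}(a) + \sum_{1 \le p \le q} (-1)^p \sum_{1 \le i_1 < \dots < i_p \le q} \mathcal{F}(a - e_{i_1}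 - \dots - e_{i_p}).$$ A rectangular domain is a set $[0,r]$ with $r \in \mathbb{Z}_+^q$; a quasi-rectangular domain is a finite union of rectangular domains. A quasi-rectangular domain $Q$ is relevant to $\mathcal{F}$ (where $\mathcal{F}$ vanishes outside $\mathbb{Z}^q_+$) if $\Delta\mathcal{F}(a) = 0$ for all $a \in \mathbb{Z}^q \setminus Q$. For each $i$, let $Z_i \subset \mathbb{P}^1$ be the projection of $X$ onto the $i$-th factor, i.e. the subscheme defined by the ideal $I(X) \cap \mathbb{K}[x_i, y_i]$, and let $s_i = \operatorname{length}(Z_i)$. Put $\rho = (s_1 - 1, \dots, s_q - 1)$ and $R(X) = [0, \rho]$. When $I(X)$ is monomial, its set of minimal monomial generators has the form $\{u_1, \dots, u_q, g_1, \dots, g_n\}$ with $n \ge 0$, where $u_i = x_i^{\alpha_i} y_i^{s_i - \alpha_i}$ is the generator of $I(X) \cap \mathbb{K}[x_i, y_i]$, and $g_1, \dots, g_n$ are the minimal generators that do not lie in any $\mathbb{K}[x_i, y_i]$. The hypothesis that $X$ is not a complete intersection is equivalent to $n \ge 1$. If $n = 1$, put $R_1 = [\deg(g_1), \rho]$. If $n > 1$, for each $l \in \{1, \dots, n\}$ put $$R_l = \bigcap_{k \in \{1, \dots, n\} \setminus \{l\}} [\deg(\operatorname{lcm}(g_k, g_l)),\, \rho].$$ *)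

theory Defs
  imports "HOL-Analysis.Analysis" "HOL-Library.Poly_Mapping"
begin

section \<open>Ideals and vector spaces of polynomials\<close>

text \<open>Polynomials over \<open>'k\<close> in variables indexed by \<open>'v\<close> are the elements of
  \<open>('v \<Rightarrow>\<^sub>0 nat) \<Rightarrow>\<^sub>0 'k\<close>. A commutative ring is a module over itself, and
  its ideals are its submodules: \<open>ideal.subspace\<close> is the property of being an ideal and
  \<open>ideal.span\<close> is the generated ideal.\<close>

type_synonym ('v, 'k) mpoly = "('v \<Rightarrow>\<^sub>0 nat) \<Rightarrow>\<^sub>0 'k"

global_interpretation ideal: module "(*) :: 'a::comm_ring_1 \<Rightarrow> 'a \<Rightarrow> 'a"
  by unfold_locales (simp_all add: algebra_simps)

definition scale :: "'k::field \<Rightarrow> ('v, 'k) mpoly \<Rightarrow> ('v, 'k) mpoly" where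
  "scale c p = Poly_Mapping.single 0 c * p"

global_interpretation mpoly: vector_space "scale :: 'k::field \<Rightarrow> ('v, 'k) mpoly \<Rightarrow> ('v, 'k) mpoly"
proof unfold_locales
  fix a b :: 'k and x y :: "('v, 'k) mpoly"
  show "scale a (x + y) = scale a x + scale a y"
    by (simp add: scale_def distrib_left)
  show "scale (a + b) x = scale a x + scale b x"
    by (simp add: scale_def single_add distrib_right)
  show "scale a (scale b x) = scale (a * b) x"
    by (simp add: scale_def mult.assoc [symmetric] mult_single)
  show "scale 1 x = x"
    by (simp add: scale_def)
qed

text \<open>\<open>B\<close> consists of elements of \<open>V\<close> whose residue classes are distinct and form a basis of
  the image of \<open>V\<close> in the quotient by \<open>W\<close>.\<close>

definition basis_modulo :: "('v, 'k::field) mpoly set \<Rightarrow> ('v, 'k) mpoly set \<Rightarrow> ('v, 'k) mpoly set \<Rightarrow> bool"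
  where "basis_modulo W V B \<longleftrightarrow> B \<subseteq> V
    \<and> (\<forall>v\<in>V. \<exists>b\<in>mpoly.span B. v - b \<in> W)
    \<and> (\<forall>T c. finite T \<and> T \<subseteq> B \<and> (\<Sum>b\<in>T. scale (c b) b) \<in> W \<longrightarrow> (\<forall>b\<in>T. c b = 0))"

definition dim_modulo :: "('v, 'k::field) mpoly set \<Rightarrow> ('v, 'k) mpoly set \<Rightarrow> nat" where
  "dim_modulo W V = card (SOME B. basis_modulo W V B)"

definition prime_ideal :: "'a::comm_ring_1 set \<Rightarrow> bool" where
  "prime_ideal P \<longleftrightarrow> ideal.subspace P \<and> P \<noteq> UNIV \<and> (\<forall>a b. a * b \<in> P \<longrightarrow> a \<in> P \<or> b \<in> P)"

text \<open>\<open>fs ! i\<close> is a nonzerodivisor modulo the preceding elements, and the quotient is nonzero.\<close>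

definition regular_sequence :: "'a::comm_ring_1 list \<Rightarrow> bool" where
  "regular_sequence fs \<longleftrightarrow> ideal.span (set fs) \<noteq> UNIV
    \<and> (\<forall>i<length fs. \<forall>h. fs ! i * h \<in> ideal.span (set (take i fs))
          \<longrightarrow> h \<in> ideal.span (set (take i fs)))"


section \<open>The coordinate ring of a product of projective lines\<close>

text \<open>The factors of the product are indexed by a finite type \<open>'q\<close>, and
  the grading group is \<open>int ^ 'q\<close> with its componentwise order.\<close>

datatype 'q hvar = XVar 'q | YVar 'q

definition mdeg :: "('q::finite hvar \<Rightarrow>\<^sub>0 nat) \<Rightarrow> int ^ 'q" where
  "mdeg m = (\<chi> i. int (Poly_Mapping.lookup m (XVar i) + Poly_Mapping.lookup m (YVar i)))"

definition forms :: "int ^ 'q \<Rightarrow> ('q::finite hvar, 'k::field) mpoly set" where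
  "forms a = {F. \<forall>m\<in>Poly_Mapping.keys F. mdeg m = a}"

text \<open>Extend a map on keys additively; \<open>push_keys (push_keys f)\<close> is then the renaming of
  variables along \<open>f\<close>.\<close>

definition push_keys :: "('a \<Rightarrow> 'b) \<Rightarrow> ('a \<Rightarrow>\<^sub>0 'c) \<Rightarrow> ('b \<Rightarrow>\<^sub>0 'c::comm_monoid_add)" where
  "push_keys h p = (\<Sum>m\<in>Poly_Mapping.keys p. Poly_Mapping.single (h m) (Poly_Mapping.lookup p m))"


section \<open>Closed subschemes\<close>

text \<open>The product is covered by the charts \<open>U\<^sub>A\<close>, for \<open>A\<close> a set of indices, where \<open>x\<^sub>i \<noteq> 0\<close>
  for \<open>i \<in> A\<close> and \<open>y\<^sub>i \<noteq> 0\<close> for \<open>i \<notin> A\<close>. Each chart is an affine space with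
  coordinates \<open>t\<^sub>i\<close>, where \<open>t\<^sub>i = y\<^sub>i / x\<^sub>i\<close> for \<open>i \<in> A\<close> and \<open>t\<^sub>i = x\<^sub>i / y\<^sub>i\<close> for \<open>i \<notin> A\<close>.\<close>

definition chart_var :: "'q set \<Rightarrow> 'q \<Rightarrow> 'q hvar" where
  "chart_var A i = (if i \<in> A then YVar i else XVar i)"

text \<open>Substitute 1 for the variables that do not vanish on \<open>U\<^sub>A\<close>. The map
  \<open>Poly_Mapping.map_key (chart_var A)\<close> restricts an exponent vector to the remaining variables.\<close>

definition dehom :: "'q set \<Rightarrow> ('q hvar, 'k::field) mpoly \<Rightarrow> ('q, 'k) mpoly" where
  "dehom A = push_keys (Poly_Mapping.map_key (chart_var A))"

definition coord :: "'q \<Rightarrow> ('q, 'k::field) mpoly" where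
  "coord i = Poly_Mapping.single (Poly_Mapping.single i 1) 1"

text \<open>A closed subscheme is a quasi-coherent ideal sheaf, given by its ideals on the charts.
  On \<open>U\<^sub>B\<close>, the overlap with \<open>U\<^sub>A\<close> is the locus where the \<open>t\<^sub>i\<close> with \<open>i\<close> in the symmetric
  difference of \<open>A\<close> and \<open>B\<close> are invertible. The two dehomogenizations of a form differ there by a
  unit, and every element of a chart ring is the dehomogenization of a form, so the
  second condition, imposed on all ordered pairs of charts, says that the extensions of the two ideals
  to the overlap agree.\<close>

type_synonym ('q, 'k) chart_ideals = "'q set \<Rightarrow> ('q, 'k) mpoly set"

definition closed_subscheme :: "('q::finite, 'k::field) chart_ideals \<Rightarrow> bool" where
  "closed_subscheme J \<longleftrightarrow> (\<forall>A. ideal.subspace (J A))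
    \<and> (\<forall>A B a. \<forall>F\<in>forms a. dehom A F \<in> J A
          \<longrightarrow> (\<exists>N. (\<Prod>i\<in>(A - B) \<union> (B - A). coord i) ^ N * dehom B F \<in> J B))"

text \<open>Nonempty, and no chart contains a chain of two distinct primes.\<close>

definition zero_dimensional :: "('q, 'k::field) chart_ideals \<Rightarrow> bool" where
  "zero_dimensional J \<longleftrightarrow> (\<exists>A. J A \<noteq> UNIV)
    \<and> (\<forall>A P Q. prime_ideal P \<and> prime_ideal Q \<and> J A \<subseteq> P \<and> P \<subseteq> Q \<longrightarrow> P = Q)"

definition vanishing_ideal :: "('q::finite, 'k::field) chart_ideals \<Rightarrow> ('q hvar, 'k) mpoly set" where
  "vanishing_ideal J = ideal.span {F. (\<exists>a. F \<in> forms a) \<and> (\<forall>A. dehom A F \<in> J A)}"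

definition hilbert_function :: "('q::finite, 'k::field) chart_ideals \<Rightarrow> int ^ 'q \<Rightarrow> int" where
  "hilbert_function J a = int (dim_modulo (vanishing_ideal J) (forms a))"

definition complete_intersection :: "('q::finite, 'k::field) chart_ideals \<Rightarrow> bool" where
  "complete_intersection J \<longleftrightarrow> (\<exists>fs. (\<forall>f\<in>set fs. \<exists>a. f \<in> forms a)
    \<and> regular_sequence fs \<and> vanishing_ideal J = ideal.span (set fs))"

definition subscheme_of :: "('q hvar, 'k::field) mpoly set \<Rightarrow> ('q, 'k) chart_ideals" where
  "subscheme_of I A = dehom A ` I"

text \<open>The length of the structure sheaf as a module over itself. Its submodules are the ideal sheaves
  of the closed subschemes of \<open>Z\<close>, ordered by inclusion on all charts. The supremum is
  meaningful only when the lengths of chains are bounded, as for zero-dimensional \<open>Z\<close>.\<close>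

definition scheme_length :: "('q::finite, 'k::field) chart_ideals \<Rightarrow> nat" where
  "scheme_length Z = Sup {n. \<exists>C. C 0 = Z \<and> (\<forall>k\<le>n. closed_subscheme (C k)) \<and> (\<forall>k<n. C k < C (Suc k))}"

text \<open>The projective line is the product indexed by \<open>unit\<close>. The ideal of \<open>K[x\<^sub>i, y\<^sub>i]\<close> cut out by
  \<open>I(X)\<close> is transported to its coordinate ring by renaming the variables.\<close>

definition embed_factor :: "'q \<Rightarrow> (unit hvar, 'k::field) mpoly \<Rightarrow> ('q hvar, 'k) mpoly" where
  "embed_factor i = push_keys (push_keys (map_hvar (\<lambda>_. i)))"

definition projection :: "'q \<Rightarrow> ('q::finite, 'k::field) chart_ideals \<Rightarrow> (unit, 'k) chart_ideals" where
  "projection i X = subscheme_of (embed_factor i -` vanishing_ideal X)"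


section \<open>Monomial ideals\<close>

text \<open>Monomials are represented by their exponent vectors.\<close>

abbreviation mon :: "('v \<Rightarrow>\<^sub>0 nat) \<Rightarrow> ('v, 'k::field) mpoly" where
  "mon m \<equiv> Poly_Mapping.single m 1"

definition monomial_ideal :: "('v, 'k::field) mpoly set \<Rightarrow> bool" where
  "monomial_ideal I \<longleftrightarrow> (\<exists>M. I = ideal.span (mon ` M))"

definition min_gens :: "('v, 'k::field) mpoly set \<Rightarrow> ('v \<Rightarrow>\<^sub>0 nat) set" where
  "min_gens I = {m. mon m \<in> I \<and> (\<forall>m'. mon m' \<in> I \<and> (mon m' :: ('v, 'k) mpoly) dvd mon m \<longrightarrow> m' = m)}"

lift_definition lcm_exp :: "('v \<Rightarrow>\<^sub>0 nat) \<Rightarrow> ('v \<Rightarrow>\<^sub>0 nat) \<Rightarrow> ('v \<Rightarrow>\<^sub>0 nat)" is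
  "\<lambda>m m' v. max (m v) (m' v)"
proof -
  fix f g :: "'v \<Rightarrow> nat"
  assume "finite {v. f v \<noteq> 0}" "finite {v. g v \<noteq> 0}"
  then show "finite {v. max (f v) (g v) \<noteq> 0}"
    by (rule_tac finite_subset [of _ "{v. f v \<noteq> 0} \<union> {v. g v \<noteq> 0}"]) auto
qed

text \<open>The minimal generators \<open>g\<^sub>1, \<dots>, g\<^sub>n\<close> that involve more than one factor.\<close>

definition mixed_gens :: "('q::finite, 'k::field) chart_ideals \<Rightarrow> ('q hvar \<Rightarrow>\<^sub>0 nat) set" where
  "mixed_gens X = {m \<in> min_gens (vanishing_ideal X).
     \<not> (\<exists>i. Poly_Mapping.keys m \<subseteq> {XVar i, YVar i})}"


section \<open>Relevant domains\<close>

definition Delta :: "(int ^ 'q \<Rightarrow> int) \<Rightarrow> int ^ 'q::finite \<Rightarrow> int" where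
  "Delta F a = (\<Sum>T\<in>Pow UNIV. (-1) ^ card T * F (a - (\<Sum>i\<in>T. axis i 1)))"

definition quasi_rectangular :: "(int ^ 'q::finite) set \<Rightarrow> bool" where
  "quasi_rectangular D \<longleftrightarrow> (\<exists>S. finite S \<and> (\<forall>r\<in>S. 0 \<le> r) \<and> D = (\<Union>r\<in>S. {0..r}))"

definition relevant_domain :: "(int ^ 'q \<Rightarrow> int) \<Rightarrow> (int ^ 'q::finite) set \<Rightarrow> bool" where
  "relevant_domain F D \<longleftrightarrow> (\<forall>a. \<not> 0 \<le> a \<longrightarrow> F a = 0)
    \<and> quasi_rectangular D \<and> (\<forall>a. a \<notin> D \<longrightarrow> Delta F a = 0)"

definition rho :: "('q::finite, 'k::field) chart_ideals \<Rightarrow> int ^ 'q" where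
  "rho X = (\<chi> i. int (scheme_length (projection i X)) - 1)"

definition R :: "('q::finite, 'k::field) chart_ideals \<Rightarrow> (int ^ 'q) set" where
  "R X = {0..rho X}"

text \<open>\<open>R_gen X g\<^sub>l\<close> is \<open>R\<^sub>l\<close>; the generators index themselves.\<close>

definition R_gen :: "('q::finite, 'k::field) chart_ideals \<Rightarrow> ('q hvar \<Rightarrow>\<^sub>0 nat) \<Rightarrow> (int ^ 'q) set" where
  "R_gen X g = (if card (mixed_gens X) = 1 then {mdeg g..rho X}
     else (\<Inter>h\<in>mixed_gens X - {g}. {mdeg (lcm_exp h g)..rho X}))"

definition D :: "('q::finite, 'k::field) chart_ideals \<Rightarrow> (int ^ 'q) set" where
  "D X = R X - (\<Union>g\<in>mixed_gens X. R_gen X g)"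

end

theory Submission
  imports Defs
begin

text \<open>
  Write \<open>I\<close> for the vanishing ideal and \<open>G\<close> for its set of minimal monomial generators. The Hilbert function counts
  the monomials of a given degree that no element of \<open>G\<close> divides. Inclusion and exclusion over \<open>G\<close>
  expresses it as an alternating sum, over the subsets \<open>T\<close> of \<open>G\<close>, of the numbers of multiples of the least common
  multiple of \<open>T\<close>. The Hilbert function of the ring itself is a product over the factors, and its difference
  function is the indicator function of the positive orthant (\<open>Delta_box\<close>). Hence the difference function of the
  Hilbert function of \<open>X\<close> at \<open>a\<close> is the sum of \<open>(-1) ^ card T\<close> over those \<open>T \<subseteq> G\<close> whose least common
  multiple has degree at most \<open>a\<close> (\<open>Delta_hilbert_function\<close>).

  This sum vanishes as soon as one generator \<open>g\<close> can be inserted into every such \<open>T\<close> without violating the degree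
  condition, because inserting and removing \<open>g\<close> is then a sign-reversing involution. If \<open>a\<close> is nonnegative but does not lie
  in \<open>R X\<close>, some \<open>u\<^sub>i\<close> can be inserted (\<open>Delta_eq_0_outside_R\<close>); if \<open>a \<in> R X\<close> lies in the set \<open>R\<^sub>l\<close>, the generator
  \<open>g\<^sub>l\<close> can be (\<open>Delta_eq_0_on_R_gen\<close>). The second case uses that each factor has only two variables: the
  degree of a least common multiple in one factor depends on at most two of the monomials, so bounds for pairs
  suffice.

  The geometric input is that the exponents of \<open>u\<^sub>i\<close> (\<open>ugen i\<close>) bound the exponents of the variables of the factor \<open>i\<close> in all
  minimal generators. By gluing, the chart ideals are the
  dehomogenizations of \<open>I\<close>, hence monomial ideals, and dimension zero forces them to
  contain powers of all coordinates (\<open>zero_dimensional_pure_power\<close>). Membership of a monomial in \<open>I\<close> is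
  tested on the charts, where these powers make larger exponents superfluous (\<open>min_gen_bounded\<close>). The degree
  of \<open>u\<^sub>i\<close> is the length of the \<open>i\<close>-th projection (\<open>projection_eq\<close> and
  \<open>scheme_length_monomial_points_line\<close>).
\<close>

section \<open>Polynomials over a field\<close>

lemma poly_eq_sum_single:
  fixes p :: "'a \<Rightarrow>\<^sub>0 'c::comm_monoid_add"
  assumes "finite M" "Poly_Mapping.keys p \<subseteq> M"
  shows "p = (\<Sum>m\<in>M. Poly_Mapping.single m (Poly_Mapping.lookup p m))"
proof (rule poly_mapping_eqI)
  fix k
  show "Poly_Mapping.lookup p k
      = Poly_Mapping.lookup (\<Sum>m\<in>M. Poly_Mapping.single m (Poly_Mapping.lookup p m)) k"
    using assms
    by (auto simp: lookup_sum lookup_single when_def sum.If_cases Int_def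
        in_keys_iff subset_iff if_distrib cong: if_cong)
qed

text \<open>Compatible maps on coefficients and on monomials determine a map on polynomials that preserves sums and
  products. Dehomogenization is of this kind, and so is the projection onto the polynomials in a single
  variable, which produces the prime ideals needed for the use of dimension zero.\<close>

locale monomial_evaluation =
  fixes c :: "'c::comm_ring_1 \<Rightarrow> 'r::comm_ring_1" and w :: "'a::comm_monoid_add \<Rightarrow> 'r"
  assumes c_zero: "c 0 = 0" and c_add: "c (a + b) = c a + c b" and c_mult: "c (a * b) = c a * c b"
    and w_add: "w (m + n) = w m * w n"
begin

definition eval_at :: "('a \<Rightarrow>\<^sub>0 'c) \<Rightarrow> 'r" where
  "eval_at p = (\<Sum>m\<in>Poly_Mapping.keys p. c (Poly_Mapping.lookup p m) * w m)"

lemma eval_at_superset: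
  assumes "finite M" "Poly_Mapping.keys p \<subseteq> M"
  shows "eval_at p = (\<Sum>m\<in>M. c (Poly_Mapping.lookup p m) * w m)"
  unfolding eval_at_def
  by (rule sum.mono_neutral_left) (use assms in \<open>auto simp: in_keys_iff c_zero\<close>)

lemma eval_at_single: "eval_at (Poly_Mapping.single m a) = c a * w m"
  by (subst eval_at_superset[of "{m}"]) auto

lemma eval_at_add: "eval_at (p + q) = eval_at p + eval_at q"
proof -
  let ?M = "Poly_Mapping.keys p \<union> Poly_Mapping.keys q"
  have "eval_at (p + q) = (\<Sum>m\<in>?M. c (Poly_Mapping.lookup (p + q) m) * w m)"
    by (rule eval_at_superset) (use Poly_Mapping.keys_add[of p q] in auto)
  also have "\<dots> = (\<Sum>m\<in>?M. c (Poly_Mapping.lookup p m) * w m) + (\<Sum>m\<in>?M. c (Poly_Mapping.lookup q m) * w m)"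
    by (simp add: lookup_add c_add distrib_right sum.distrib)
  also have "\<dots> = eval_at p + eval_at q"
    by (simp add: eval_at_superset[of ?M p] eval_at_superset[of ?M q])
  finally show ?thesis .
qed

lemma eval_at_zero [simp]: "eval_at 0 = 0"
  by (simp add: eval_at_def)

lemma eval_at_sum: "eval_at (\<Sum>x\<in>S. f x) = (\<Sum>x\<in>S. eval_at (f x))"
  by (induction S rule: infinite_finite_induct) (auto simp: eval_at_add)

lemma eval_at_mult: "eval_at (p * q) = eval_at p * eval_at q"
proof -
  let ?P = "Poly_Mapping.keys p" and ?Q = "Poly_Mapping.keys q"
  have "p * q = (\<Sum>m\<in>?P. Poly_Mapping.single m (Poly_Mapping.lookup p m))
      * (\<Sum>n\<in>?Q. Poly_Mapping.single n (Poly_Mapping.lookup q n))"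
    using poly_eq_sum_single[of ?P p] poly_eq_sum_single[of ?Q q] by simp
  also have "\<dots> = (\<Sum>m\<in>?P. \<Sum>n\<in>?Q. Poly_Mapping.single (m + n) (Poly_Mapping.lookup p m * Poly_Mapping.lookup q n))"
    by (simp add: sum_product mult_single)
  finally have "eval_at (p * q) = eval_at (\<Sum>m\<in>?P. \<Sum>n\<in>?Q.
      Poly_Mapping.single (m + n) (Poly_Mapping.lookup p m * Poly_Mapping.lookup q n))"
    by (rule arg_cong)
  also have "\<dots> = (\<Sum>m\<in>?P. \<Sum>n\<in>?Q.
      c (Poly_Mapping.lookup p m) * c (Poly_Mapping.lookup q n) * (w m * w n))"
    by (simp only: eval_at_sum eval_at_single c_mult w_add)
  also have "\<dots> = (\<Sum>m\<in>?P. \<Sum>n\<in>?Q.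
      (c (Poly_Mapping.lookup p m) * w m) * (c (Poly_Mapping.lookup q n) * w n))"
    by (simp only: mult.assoc mult.left_commute)
  also have "\<dots> = eval_at p * eval_at q"
    by (simp add: eval_at_def sum_product)
  finally show ?thesis .
qed

end

lemma keys_push_keys: "Poly_Mapping.keys (push_keys h p) \<subseteq> h ` Poly_Mapping.keys p"
  unfolding push_keys_def using keys_sum by (fastforce split: if_splits)

lemma push_keys_superset:
  assumes "finite M" "Poly_Mapping.keys p \<subseteq> M"
  shows "push_keys h p = (\<Sum>m\<in>M. Poly_Mapping.single (h m) (Poly_Mapping.lookup p m))"
  unfolding push_keys_def
  by (rule sum.mono_neutral_left) (use assms in \<open>auto simp: in_keys_iff\<close>)

lemma push_keys_single [simp]: "push_keys h (Poly_Mapping.single m a) = Poly_Mapping.single (h m) a"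
  by (subst push_keys_superset[of "{m}"]) auto

lemma push_keys_zero [simp]: "push_keys h 0 = 0"
  by (simp add: push_keys_def)

lemma push_keys_add: "push_keys h (p + q) = push_keys h p + push_keys h q"
proof -
  let ?M = "Poly_Mapping.keys p \<union> Poly_Mapping.keys q"
  show ?thesis
    using Poly_Mapping.keys_add[of p q]
    by (simp add: push_keys_superset[of ?M] lookup_add single_add sum.distrib)
qed

lemma push_keys_sum: "push_keys h (\<Sum>x\<in>S. f x) = (\<Sum>x\<in>S. push_keys h (f x))"
  by (induction S rule: infinite_finite_induct) (auto simp: push_keys_add)

lemma push_keys_compose: "push_keys g (push_keys h p) = push_keys (\<lambda>m. g (h m)) p"
  by (simp add: push_keys_def[of h p] push_keys_sum push_keys_def[of "\<lambda>m. g (h m)"])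

lemma push_keys_ident: "(\<And>m. m \<in> Poly_Mapping.keys p \<Longrightarrow> h m = m) \<Longrightarrow> push_keys h p = p"
  unfolding push_keys_def by (subst (4) poly_eq_sum_single[of "Poly_Mapping.keys p"]) auto

lemma push_keys_mult:
  fixes p q :: "'a::comm_monoid_add \<Rightarrow>\<^sub>0 'c::comm_ring_1" and h :: "'a \<Rightarrow> 'b::comm_monoid_add"
  assumes h: "\<And>m n. h (m + n) = h m + h n"
  shows "push_keys h (p * q) = push_keys h p * push_keys h q"
proof -
  interpret monomial_evaluation "Poly_Mapping.single 0" "\<lambda>m. Poly_Mapping.single (h m) (1::'c)"
    by unfold_locales (auto simp: single_add mult_single h)
  have "eval_at p = push_keys h p" for p :: "'a \<Rightarrow>\<^sub>0 'c"
    unfolding eval_at_def push_keys_def by (simp add: mult_single)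
  with eval_at_mult show ?thesis by metis
qed

lemma lookup_push_keys_inj:
  assumes "inj h"
  shows "Poly_Mapping.lookup (push_keys h p) (h m) = Poly_Mapping.lookup p m"
  using assms
  by (auto simp: push_keys_def lookup_sum lookup_single when_def sum.If_cases Int_def inj_eq
      in_keys_iff if_distrib cong: if_cong)

lemma keys_push_keys_inj:
  assumes "inj h"
  shows "Poly_Mapping.keys (push_keys h p) = h ` Poly_Mapping.keys p"
  using keys_push_keys[of h p] lookup_push_keys_inj[OF assms, of p] by (auto simp: in_keys_iff)


section \<open>Monomials and monomial ideals\<close>

definition divides_exp :: "('v \<Rightarrow>\<^sub>0 nat) \<Rightarrow> ('v \<Rightarrow>\<^sub>0 nat) \<Rightarrow> bool" where
  "divides_exp l m \<longleftrightarrow> (\<forall>v. Poly_Mapping.lookup l v \<le> Poly_Mapping.lookup m v)"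

lemma divides_expE:
  assumes "divides_exp l m"
  obtains n where "m = n + l"
proof
  show "m = (m - l) + l"
    using assms by (auto simp: divides_exp_def lookup_add lookup_minus intro!: poly_mapping_eqI)
qed

lemma divides_exp_add [simp]: "divides_exp l (n + l)" "divides_exp l (l + n)"
  by (auto simp: divides_exp_def lookup_add)

lemma divides_exp_refl [simp]: "divides_exp m m"
  by (simp add: divides_exp_def)

lemma divides_exp_trans: "divides_exp k l \<Longrightarrow> divides_exp l m \<Longrightarrow> divides_exp k m"
  unfolding divides_exp_def using le_trans by blast

lemma divides_exp_antisym: "divides_exp l m \<Longrightarrow> divides_exp m l \<Longrightarrow> l = m"
  unfolding divides_exp_def by (intro poly_mapping_eqI antisym) auto

lemma mon_dvd_mon_iff: "(mon l :: ('v, 'k::field) mpoly) dvd mon m \<longleftrightarrow> divides_exp l m"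
proof
  assume "(mon l :: ('v, 'k) mpoly) dvd mon m"
  then obtain q where "(mon m :: ('v, 'k) mpoly) = mon l * q"
    by (auto elim: dvdE)
  then have "m \<in> Poly_Mapping.keys (mon l * q)"
    by (metis in_keys_iff lookup_single_eq one_neq_zero)
  then show "divides_exp l m"
    using keys_mult[of "mon l" q] by auto
next
  assume "divides_exp l m"
  then obtain n where "m = n + l" by (rule divides_expE)
  then have "(mon m :: ('v, 'k) mpoly) = mon l * mon n"
    by (simp add: mult_single add.commute)
  then show "(mon l :: ('v, 'k) mpoly) dvd mon m" by simp
qed

lemma ideal_mon_divides:
  assumes "ideal.subspace I" "(mon l :: ('v, 'k::field) mpoly) \<in> I" "divides_exp l m"
  shows "mon m \<in> I"
proof -
  obtain n where "m = n + l" using assms(3) by (rule divides_expE)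
  then have "mon m = mon n * (mon l :: ('v, 'k) mpoly)" by (simp add: mult_single)
  with assms ideal.subspace_scale show ?thesis by metis
qed

text \<open>This form of being a monomial ideal decides membership term by term, and passes from the vanishing ideal to
  the chart ideals because dehomogenization maps terms to terms.\<close>

definition support_closed :: "('v, 'k::field) mpoly set \<Rightarrow> bool" where
  "support_closed I \<longleftrightarrow> ideal.subspace I \<and> (\<forall>f\<in>I. \<forall>m\<in>Poly_Mapping.keys f. mon m \<in> I)"

lemma ideal_contains_if_keys:
  assumes "ideal.subspace I" "\<forall>m\<in>Poly_Mapping.keys f. mon m \<in> I"
  shows "(f :: ('v, 'k::field) mpoly) \<in> I"
proof -
  have "Poly_Mapping.single m (Poly_Mapping.lookup f m) \<in> I" if "m \<in> Poly_Mapping.keys f" for m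
  proof -
    have "Poly_Mapping.single m (Poly_Mapping.lookup f m)
        = Poly_Mapping.single 0 (Poly_Mapping.lookup f m) * mon m"
      by (simp add: mult_single)
    then show ?thesis
      using assms that ideal.subspace_scale by metis
  qed
  then have "(\<Sum>m\<in>Poly_Mapping.keys f. Poly_Mapping.single m (Poly_Mapping.lookup f m)) \<in> I"
    by (intro ideal.subspace_sum assms) auto
  then show ?thesis
    using poly_eq_sum_single[of "Poly_Mapping.keys f" f] by simp
qed

lemma support_closed_iff:
  "support_closed I \<Longrightarrow> f \<in> I \<longleftrightarrow> (\<forall>m\<in>Poly_Mapping.keys f. mon m \<in> I)"
  unfolding support_closed_def using ideal_contains_if_keys by blast

text \<open>The polynomials all of whose monomials are multiples of given generators form an ideal
  containing those generators.\<close>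

lemma support_closed_monomial_ideal:
  assumes "monomial_ideal (I :: ('v, 'k::field) mpoly set)"
  shows "support_closed I"
proof -
  obtain M where I: "I = ideal.span (mon ` M)"
    using assms by (auto simp: monomial_ideal_def)
  have sub: "ideal.subspace I" by (simp add: I)
  let ?V = "{f :: ('v, 'k) mpoly. \<forall>k\<in>Poly_Mapping.keys f. \<exists>m\<in>M. divides_exp m k}"
  have "I \<subseteq> ?V"
    unfolding I
  proof (rule ideal.span_minimal)
    show "mon ` M \<subseteq> ?V" by (auto intro: divides_exp_refl)
    show "ideal.subspace ?V"
    proof (rule ideal.subspaceI)
      fix f g :: "('v, 'k) mpoly"
      assume "f \<in> ?V" "g \<in> ?V"
      then show "f + g \<in> ?V"
        using Poly_Mapping.keys_add[of f g] by blast
    next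
      fix c f :: "('v, 'k) mpoly"
      assume f: "f \<in> ?V"
      have "\<exists>m\<in>M. divides_exp m k" if k: "k \<in> Poly_Mapping.keys (c * f)" for k
      proof -
        obtain a b where "k = a + b" "b \<in> Poly_Mapping.keys f"
          using k keys_mult[of c f] by blast
        with f show ?thesis by (blast intro: divides_exp_trans divides_exp_add)
      qed
      then show "c * f \<in> ?V" by simp
    qed simp
  qed
  moreover have "mon m \<in> I" if "m \<in> M" for m
    using that by (auto simp: I intro: ideal.span_base)
  ultimately show ?thesis
    using sub ideal_mon_divides[OF sub] unfolding support_closed_def by blast
qed

lemma min_gens_iff:
  "m \<in> min_gens (I :: ('v, 'k::field) mpoly set) \<longleftrightarrow>
     mon m \<in> I \<and> (\<forall>l. mon l \<in> I \<and> divides_exp l m \<longrightarrow> l = m)"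
  by (simp add: min_gens_def mon_dvd_mon_iff)

instance hvar :: (finite) finite
proof
  have "(UNIV :: 'a hvar set) = range XVar \<union> range YVar"
    by (metis UNIV_eq_I UnI1 UnI2 hvar.exhaust rangeI)
  then show "finite (UNIV :: 'a hvar set)"
    by (metis finite finite_UnI finite_imageI)
qed

text \<open>Among the divisors of \<open>m\<close> in \<open>I\<close>, one of least total degree has no proper divisor in \<open>I\<close>.\<close>

lemma min_gen_divides:
  fixes m :: "'v::finite \<Rightarrow>\<^sub>0 nat"
  assumes "(mon m :: ('v, 'k::field) mpoly) \<in> I"
  obtains g where "g \<in> min_gens I" "divides_exp g m"
proof -
  let ?P = "\<lambda>g. (mon g :: ('v, 'k) mpoly) \<in> I \<and> divides_exp g m"
  let ?size = "\<lambda>g :: 'v \<Rightarrow>\<^sub>0 nat. \<Sum>v\<in>UNIV. Poly_Mapping.lookup g v"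
  obtain g where g: "?P g" and least: "\<And>h. ?P h \<Longrightarrow> ?size g \<le> ?size h"
    using ex_has_least_nat[of ?P m ?size] assms by auto
  have "l = g" if l: "mon l \<in> I" "divides_exp l g" for l
  proof (rule ccontr)
    assume "l \<noteq> g"
    then obtain v where v: "Poly_Mapping.lookup l v \<noteq> Poly_Mapping.lookup g v"
      by (meson poly_mapping_eqI)
    have "?size l < ?size g"
    proof (rule sum_strict_mono_ex1)
      show "\<forall>x\<in>UNIV. Poly_Mapping.lookup l x \<le> Poly_Mapping.lookup g x"
        using l by (simp add: divides_exp_def)
      show "\<exists>a\<in>UNIV. Poly_Mapping.lookup l a < Poly_Mapping.lookup g a"
        using l v by (auto simp: divides_exp_def intro!: exI[of _ v] le_neq_implies_less)
    qed simp
    moreover have "?P l" using l g divides_exp_trans by blast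
    ultimately show False using least by fastforce
  qed
  with g have "g \<in> min_gens I" by (simp add: min_gens_iff)
  with g that show ?thesis by blast
qed


section \<open>Charts and the vanishing ideal\<close>

lemma inj_chart_var: "inj (chart_var A)"
  by (auto simp: inj_def chart_var_def split: if_splits)

lemma lookup_map_key_chart [simp]:
  "Poly_Mapping.lookup (Poly_Mapping.map_key (chart_var A) m) i = Poly_Mapping.lookup m (chart_var A i)"
  by (simp add: map_key.rep_eq[OF inj_chart_var])

lemma dehom_mon: "dehom A (Poly_Mapping.single m c) = Poly_Mapping.single (Poly_Mapping.map_key (chart_var A) m) c"
  by (simp add: dehom_def)

lemma dehom_mult: "dehom A (F * G) = dehom A F * dehom A G"
  unfolding dehom_def by (rule push_keys_mult) (rule map_key_plus[OF inj_chart_var])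

lemma dehom_add: "dehom A (F + G) = dehom A F + dehom A G"
  unfolding dehom_def by (rule push_keys_add)

lemma mdeg_nth: "mdeg m $ i = int (Poly_Mapping.lookup m (XVar i) + Poly_Mapping.lookup m (YVar i))"
  by (simp add: mdeg_def)

lemma mdeg_add: "mdeg (m + n) = mdeg m + mdeg n"
  by (simp add: vec_eq_iff mdeg_nth lookup_add)

lemma mon_in_forms: "mon m \<in> forms (mdeg m)"
  by (simp add: forms_def)

lemma dehom_vanishing_ideal:
  assumes "closed_subscheme X" "F \<in> vanishing_ideal X"
  shows "dehom A F \<in> X A"
proof -
  have sub: "ideal.subspace (X A)" for A using assms by (simp add: closed_subscheme_def)
  have "vanishing_ideal X \<subseteq> {F. dehom A F \<in> X A}"
    unfolding vanishing_ideal_def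
  proof (rule ideal.span_minimal)
    show "ideal.subspace {F. dehom A F \<in> X A}"
      using sub[of A]
      by (auto intro!: ideal.subspaceI intro: ideal.subspace_add ideal.subspace_scale ideal.subspace_0
          simp: dehom_add dehom_mult) (simp add: dehom_def ideal.subspace_0)
  qed auto
  with assms show ?thesis by auto
qed

text \<open>This is where saturation enters: membership of a monomial is tested separately on each chart, and the
  test on the chart \<open>A\<close> sees only the exponents of the variables that can vanish there.\<close>

lemma mon_in_vanishing_ideal_iff:
  assumes "closed_subscheme X"
  shows "mon m \<in> vanishing_ideal X \<longleftrightarrow> (\<forall>A. mon (Poly_Mapping.map_key (chart_var A) m) \<in> X A)"
proof
  assume "mon m \<in> vanishing_ideal X"
  with dehom_vanishing_ideal[OF assms] dehom_mon
  show "\<forall>A. mon (Poly_Mapping.map_key (chart_var A) m) \<in> X A" by metis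
next
  assume "\<forall>A. mon (Poly_Mapping.map_key (chart_var A) m) \<in> X A"
  then show "mon m \<in> vanishing_ideal X"
    unfolding vanishing_ideal_def using mon_in_forms
    by (intro ideal.span_base) (auto simp: dehom_mon)
qed

lemma coord_power_prod:
  "(\<Prod>i\<in>S. coord i :: ('q, 'k::field) mpoly) ^ N = mon (Abs_poly_mapping (\<lambda>i::'q::finite. if i \<in> S then N else 0))"
proof -
  have "(coord i :: ('q, 'k) mpoly) ^ N = Poly_Mapping.single (Poly_Mapping.single i N) 1" for i :: 'q
    by (induction N) (simp_all add: coord_def mult_single flip: single_add)
  then have "(\<Prod>i\<in>S. coord i :: ('q, 'k) mpoly) ^ N = (\<Prod>i\<in>S. Poly_Mapping.single (Poly_Mapping.single i N) 1)"
    by (simp add: prod_power_distrib)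
  also have "\<dots> = mon (\<Sum>i\<in>S. Poly_Mapping.single i N)"
    by (induction S rule: infinite_finite_induct) (simp_all add: mult_single)
  also have "(\<Sum>i\<in>S. Poly_Mapping.single i N) = Abs_poly_mapping (\<lambda>i. if i \<in> S then N else 0)"
    by (rule poly_mapping_eqI)
      (simp add: lookup_sum lookup_single when_def)
  finally show ?thesis .
qed

text \<open>Homogenization on the chart \<open>A\<close> to degree \<open>N\<close> in every factor; the degree is as intended only if no
  exponent in \<open>k\<close> exceeds \<open>N\<close>, because of the truncated subtraction.\<close>

definition homogenize_exp :: "'q set \<Rightarrow> nat \<Rightarrow> ('q::finite \<Rightarrow>\<^sub>0 nat) \<Rightarrow> ('q hvar \<Rightarrow>\<^sub>0 nat)" where
  "homogenize_exp A N k = Abs_poly_mapping (\<lambda>v. case v of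
     XVar i \<Rightarrow> if i \<in> A then N - Poly_Mapping.lookup k i else Poly_Mapping.lookup k i
   | YVar i \<Rightarrow> if i \<in> A then Poly_Mapping.lookup k i else N - Poly_Mapping.lookup k i)"

lemma dehom_homogenize: "dehom A (push_keys (homogenize_exp A N) f) = f"
  unfolding dehom_def push_keys_compose
  by (rule push_keys_ident, rule poly_mapping_eqI) (auto simp: homogenize_exp_def chart_var_def)

text \<open>Homogenize \<open>f\<close> to a form \<open>G\<close>. By the gluing condition, \<open>dehom B G\<close> falls into \<open>X B\<close> after multiplication by a
  power of the coordinates indexed by the symmetric difference of \<open>A\<close> and \<open>B\<close>. Multiplying \<open>G\<close> by a high power
  of all variables that are invertible on the chart \<open>A\<close> supplies these coordinates on every other chart
  simultaneously and changes nothing on \<open>A\<close>.\<close>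

lemma chart_ideal_from_vanishing_ideal:
  fixes X :: "('q::finite, 'k::field) chart_ideals"
  assumes X: "closed_subscheme X" and f: "f \<in> X A"
  obtains F where "F \<in> vanishing_ideal X" "dehom A F = f"
proof -
  define N where "N = (\<Sum>k\<in>Poly_Mapping.keys f. \<Sum>i\<in>UNIV. Poly_Mapping.lookup k i)"
  have N: "Poly_Mapping.lookup k i \<le> N" if "k \<in> Poly_Mapping.keys f" for k i
  proof -
    have "Poly_Mapping.lookup k i \<le> (\<Sum>i\<in>UNIV. Poly_Mapping.lookup k i)"
      by (rule member_le_sum) auto
    also have "\<dots> \<le> N"
      unfolding N_def using that by (intro member_le_sum) auto
    finally show ?thesis .
  qed
  define G where "G = push_keys (homogenize_exp A N) f"
  have "mdeg (homogenize_exp A N k) = (\<chi> i. int N)" if "k \<in> Poly_Mapping.keys f" for k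
    using N[OF that] by (auto simp: vec_eq_iff mdeg_nth homogenize_exp_def)
  then have G: "G \<in> forms (\<chi> i. int N)"
    using keys_push_keys[of "homogenize_exp A N" f] by (auto simp: forms_def G_def)
  have AG: "dehom A G = f" by (simp add: G_def dehom_homogenize)
  have "\<exists>M. (\<Prod>i\<in>(A - B) \<union> (B - A). coord i) ^ M * dehom B G \<in> X B" for B
    using X G AG f unfolding closed_subscheme_def by metis
  then obtain M where M: "(\<Prod>i\<in>(A - B) \<union> (B - A). coord i) ^ M B * dehom B G \<in> X B" for B
    by metis
  define L where "L = (\<Sum>B\<in>UNIV. M B)"
  have L: "M B \<le> L" for B unfolding L_def by (rule member_le_sum) auto
  define e where "e = Abs_poly_mapping (\<lambda>v. case v of
     XVar i \<Rightarrow> if i \<in> A then L else 0 | YVar i \<Rightarrow> if i \<in> A then 0 else L)"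
  have "Poly_Mapping.map_key (chart_var B) e
      = Abs_poly_mapping (\<lambda>i. if i \<in> (A - B) \<union> (B - A) then L else 0)" for B
    by (rule poly_mapping_eqI) (auto simp: e_def chart_var_def)
  then have e: "dehom B (mon e) = (\<Prod>i\<in>(A - B) \<union> (B - A). coord i :: ('q, 'k) mpoly) ^ L" for B
    by (simp add: dehom_mon coord_power_prod)
  define F where "F = mon e * G"
  have "mdeg m = mdeg e + (\<chi> i. int N)" if "m \<in> Poly_Mapping.keys F" for m
    using that keys_mult[of "mon e" G] G by (force simp: F_def forms_def mdeg_add)
  then have "F \<in> forms (mdeg e + (\<chi> i. int N))" by (simp add: forms_def)
  moreover have "dehom B F \<in> X B" for B
  proof -
    let ?p = "\<Prod>i\<in>(A - B) \<union> (B - A). coord i :: ('q, 'k) mpoly"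
    have "dehom B F = ?p ^ (L - M B) * (?p ^ M B * dehom B G)"
      using L[of B] by (simp add: F_def dehom_mult e mult.assoc[symmetric] flip: power_add)
    then show ?thesis
      using M[of B] X ideal.subspace_scale unfolding closed_subscheme_def by metis
  qed
  ultimately have "F \<in> vanishing_ideal X"
    unfolding vanishing_ideal_def by (intro ideal.span_base) auto
  moreover have "dehom A F = f"
    by (simp add: F_def dehom_mult e AG)
  ultimately show ?thesis using that by blast
qed

lemma support_closed_chart:
  assumes X: "closed_subscheme X" and I: "support_closed (vanishing_ideal X)"
  shows "support_closed (X A)"
proof -
  have "mon k \<in> X A" if f: "f \<in> X A" and k: "k \<in> Poly_Mapping.keys f" for f k
  proof -
    obtain F where F: "F \<in> vanishing_ideal X" "dehom A F = f"
      using chart_ideal_from_vanishing_ideal[OF X f] by blast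
    then obtain m where m: "m \<in> Poly_Mapping.keys F" "k = Poly_Mapping.map_key (chart_var A) m"
      using k keys_push_keys[of "Poly_Mapping.map_key (chart_var A)" F] by (auto simp: dehom_def)
    have "mon m \<in> vanishing_ideal X"
      using I F m by (auto simp: support_closed_def)
    then show ?thesis
      using m mon_in_vanishing_ideal_iff[OF X] by blast
  qed
  then show ?thesis
    using X by (auto simp: support_closed_def closed_subscheme_def)
qed

text \<open>If the chart ideal contained no power of \<open>t\<^sub>i\<close>, each of its monomials would involve some other
  coordinate. So it would lie in the prime \<open>P\<close> generated by the coordinates different from \<open>t\<^sub>i\<close>, and \<open>P\<close> is
  strictly contained in the prime \<open>Q\<close> generated by all coordinates. Both primes arise as kernels: of
  the projection to \<open>K[t\<^sub>i]\<close>, and of this projection followed by evaluation at 0.\<close>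

lemma zero_dimensional_pure_power:
  fixes X :: "('q::finite, 'k::field) chart_ideals"
  assumes X: "closed_subscheme X" "zero_dimensional X" and I: "support_closed (vanishing_ideal X)"
  shows "\<exists>e. mon (Poly_Mapping.single i e) \<in> X A"
proof (rule ccontr)
  assume none: "\<not> ?thesis"
  have keys_plus: "Poly_Mapping.keys (m + n) = Poly_Mapping.keys m \<union> Poly_Mapping.keys n"
    for m n :: "'q \<Rightarrow>\<^sub>0 nat"
    by (auto simp: in_keys_iff lookup_add)
  interpret monomial_evaluation "\<lambda>c::'k. [:c:]"
    "\<lambda>m :: 'q \<Rightarrow>\<^sub>0 nat. if Poly_Mapping.keys m \<subseteq> {i} then monom 1 (Poly_Mapping.lookup m i) else 0"
    by unfold_locales (auto simp: keys_plus lookup_add mult_monom)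
  define P where "P = {f. eval_at f = 0}"
  define Q where "Q = {f. poly (eval_at f) 0 = 0}"
  have one: "eval_at 1 = 1"
    using eval_at_single[of 0 1] by simp
  have "ideal.subspace P" "ideal.subspace Q"
    by (auto intro!: ideal.subspaceI simp: P_def Q_def eval_at_add eval_at_mult)
  moreover have "1 \<notin> P" "1 \<notin> Q" by (simp_all add: P_def Q_def one)
  then have "P \<noteq> UNIV" "Q \<noteq> UNIV" by auto
  moreover have "a \<in> P \<or> b \<in> P" if "a * b \<in> P" for a b
    using that by (simp add: P_def eval_at_mult)
  moreover have "a \<in> Q \<or> b \<in> Q" if "a * b \<in> Q" for a b
    using that by (simp add: Q_def eval_at_mult)
  ultimately have "prime_ideal P" "prime_ideal Q"
    unfolding prime_ideal_def by blast+
  moreover have "P \<subseteq> Q" by (auto simp: P_def Q_def)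
  moreover have "X A \<subseteq> P"
  proof
    fix f assume f: "f \<in> X A"
    have "\<not> Poly_Mapping.keys m \<subseteq> {i}" if "m \<in> Poly_Mapping.keys f" for m
    proof
      assume "Poly_Mapping.keys m \<subseteq> {i}"
      then have "m = Poly_Mapping.single i (Poly_Mapping.lookup m i)"
        by (intro poly_mapping_eqI) (auto simp: lookup_single when_def in_keys_iff)
      moreover have "mon m \<in> X A"
        using support_closed_chart[OF X(1) I] f that by (auto simp: support_closed_def)
      ultimately show False using none by metis
    qed
    then show "f \<in> P" by (simp add: P_def eval_at_def)
  qed
  ultimately have "P = Q" using X(2) unfolding zero_dimensional_def by blast
  have "eval_at (mon (Poly_Mapping.single i 1)) = monom 1 1"
    by (simp add: eval_at_single)
  then have "mon (Poly_Mapping.single i 1) \<in> Q" "mon (Poly_Mapping.single i 1) \<notin> P"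
    by (simp_all add: P_def Q_def poly_monom)
  with \<open>P = Q\<close> show False by simp
qed

locale monomial_points =
  fixes X :: "('q::finite, 'k::field) chart_ideals"
  assumes closed: "closed_subscheme X" and zero_dim: "zero_dimensional X"
    and monomial: "monomial_ideal (vanishing_ideal X)"
begin

abbreviation I :: "('q hvar, 'k) mpoly set" where "I \<equiv> vanishing_ideal X"

lemma supp: "support_closed I"
  using monomial by (rule support_closed_monomial_ideal)

lemma subspace_I: "ideal.subspace I"
  using supp by (simp add: support_closed_def)

lemma subspace_chart: "ideal.subspace (X A)"
  using closed by (simp add: closed_subscheme_def)

lemma chart_mon_mono:
  assumes "mon k \<in> X A" "\<And>j. Poly_Mapping.lookup k j \<le> Poly_Mapping.lookup l j"
  shows "mon l \<in> X A"
  using ideal_mon_divides[OF subspace_chart assms(1)] assms(2) by (simp add: divides_exp_def)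

text \<open>The charts with \<open>i \<notin> A\<close> are those on which \<open>XVar i\<close> is a coordinate. Together with
  \<open>yexp\<close>, these are the exponents of the generator of the part of \<open>I\<close> in the variables of the factor
  \<open>i\<close>.\<close>

definition xexp :: "'q \<Rightarrow> nat" where
  "xexp i = (LEAST a. \<forall>A. i \<notin> A \<longrightarrow> mon (Poly_Mapping.single i a) \<in> X A)"

definition yexp :: "'q \<Rightarrow> nat" where
  "yexp i = (LEAST b. \<forall>A. i \<in> A \<longrightarrow> mon (Poly_Mapping.single i b) \<in> X A)"

lemma common_pure_power: "\<exists>e. \<forall>A. mon (Poly_Mapping.single i e) \<in> X A"
proof -
  obtain e where e: "mon (Poly_Mapping.single i (e A)) \<in> X A" for A
    using zero_dimensional_pure_power[OF closed zero_dim supp] by metis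
  have "e A \<le> (\<Sum>A\<in>UNIV. e A)" for A by (rule member_le_sum) auto
  then have "mon (Poly_Mapping.single i (\<Sum>A\<in>UNIV. e A)) \<in> X A" for A
    by (intro chart_mon_mono[OF e]) (auto simp: lookup_single when_def)
  then show ?thesis by blast
qed

lemma x_pure_power_iff:
  "(\<forall>A. i \<notin> A \<longrightarrow> mon (Poly_Mapping.single i a) \<in> X A) \<longleftrightarrow> xexp i \<le> a"
proof
  assume "xexp i \<le> a"
  moreover have "\<forall>A. i \<notin> A \<longrightarrow> mon (Poly_Mapping.single i (xexp i)) \<in> X A"
    unfolding xexp_def by (rule LeastI_ex) (use common_pure_power in blast)
  ultimately show "\<forall>A. i \<notin> A \<longrightarrow> mon (Poly_Mapping.single i a) \<in> X A"
    by (auto intro: chart_mon_mono simp: lookup_single when_def)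
qed (auto simp: xexp_def intro: Least_le)

lemma y_pure_power_iff:
  "(\<forall>A. i \<in> A \<longrightarrow> mon (Poly_Mapping.single i a) \<in> X A) \<longleftrightarrow> yexp i \<le> a"
proof
  assume "yexp i \<le> a"
  moreover have "\<forall>A. i \<in> A \<longrightarrow> mon (Poly_Mapping.single i (yexp i)) \<in> X A"
    unfolding yexp_def by (rule LeastI_ex) (use common_pure_power in blast)
  ultimately show "\<forall>A. i \<in> A \<longrightarrow> mon (Poly_Mapping.single i a) \<in> X A"
    by (auto intro: chart_mon_mono simp: lookup_single when_def)
qed (auto simp: yexp_def intro: Least_le)

definition ugen :: "'q \<Rightarrow> ('q hvar \<Rightarrow>\<^sub>0 nat)" where
  "ugen i = Poly_Mapping.single (XVar i) (xexp i) + Poly_Mapping.single (YVar i) (yexp i)"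

lemma lookup_ugen [simp]:
  "Poly_Mapping.lookup (ugen i) (XVar j) = (if i = j then xexp i else 0)"
  "Poly_Mapping.lookup (ugen i) (YVar j) = (if i = j then yexp i else 0)"
  by (auto simp: ugen_def lookup_add lookup_single when_def)

text \<open>On each chart only one of the two exponents counts, so the conditions on them are independent
  and the monomials in \<open>I\<close> of a single factor are the multiples of one monomial.\<close>

lemma single_factor_in_I_iff:
  assumes m: "Poly_Mapping.keys m \<subseteq> {XVar i, YVar i}"
  shows "mon m \<in> I \<longleftrightarrow>
    xexp i \<le> Poly_Mapping.lookup m (XVar i) \<and> yexp i \<le> Poly_Mapping.lookup m (YVar i)"
proof -
  have "Poly_Mapping.map_key (chart_var A) m = Poly_Mapping.single i (Poly_Mapping.lookup m (chart_var A i))" for A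
  proof (rule poly_mapping_eqI)
    fix j
    show "Poly_Mapping.lookup (Poly_Mapping.map_key (chart_var A) m) j
      = Poly_Mapping.lookup (Poly_Mapping.single i (Poly_Mapping.lookup m (chart_var A i))) j"
    proof (cases "j = i")
      case False
      then have "chart_var A j \<notin> Poly_Mapping.keys m"
        using m by (auto simp: chart_var_def split: if_splits)
      with False show ?thesis by (simp add: in_keys_iff lookup_single when_def)
    qed simp
  qed
  then have "mon m \<in> I \<longleftrightarrow> (\<forall>A. mon (Poly_Mapping.single i (Poly_Mapping.lookup m (chart_var A i))) \<in> X A)"
    by (simp add: mon_in_vanishing_ideal_iff[OF closed])
  also have "\<dots> \<longleftrightarrow> (\<forall>A. (i \<notin> A \<longrightarrow> mon (Poly_Mapping.single i (Poly_Mapping.lookup m (XVar i))) \<in> X A)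
      \<and> (i \<in> A \<longrightarrow> mon (Poly_Mapping.single i (Poly_Mapping.lookup m (YVar i))) \<in> X A))"
    by (rule iff_allI) (simp add: chart_var_def)
  finally show ?thesis
    by (simp only: all_conj_distrib x_pure_power_iff y_pure_power_iff)
qed

lemma keys_ugen: "Poly_Mapping.keys (ugen i) \<subseteq> {XVar i, YVar i}"
  using Poly_Mapping.keys_add by (fastforce simp: ugen_def split: if_splits)

lemma ugen_in_I: "mon (ugen i) \<in> I"
  using single_factor_in_I_iff[OF keys_ugen] by simp

lemma I_proper: "mon 0 \<notin> I"
proof
  assume "mon 0 \<in> I"
  then have "mon 0 \<in> X A" for A
    by (metis mon_in_vanishing_ideal_iff[OF closed] map_key_zero[OF inj_chart_var])
  then have "1 * f \<in> X A" for A f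
    using ideal.subspace_scale[OF subspace_chart] by (metis mult.commute single_one)
  then have "X A = UNIV" for A by auto
  then show False using zero_dim by (simp add: zero_dimensional_def)
qed

lemma ugen_nonzero: "xexp i + yexp i > 0"
proof (rule ccontr)
  assume "\<not> ?thesis"
  then have "mon 0 \<in> I" using single_factor_in_I_iff[of 0 i] by simp
  with I_proper show False by simp
qed

lemma ugen_min_gen: "ugen i \<in> min_gens I"
proof -
  have "l = ugen i" if l: "mon l \<in> I" "divides_exp l (ugen i)" for l
  proof -
    have "Poly_Mapping.keys l \<subseteq> Poly_Mapping.keys (ugen i)"
      using l(2) by (auto simp: divides_exp_def in_keys_iff) (meson less_le_trans)
    with keys_ugen have l': "Poly_Mapping.keys l \<subseteq> {XVar i, YVar i}" by blast
    then have "divides_exp (ugen i) l"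
      unfolding divides_exp_def
    proof (intro allI)
      fix v show "Poly_Mapping.lookup (ugen i) v \<le> Poly_Mapping.lookup l v"
        using single_factor_in_I_iff[OF l'] l(1) by (cases v) auto
    qed
    with l show ?thesis using divides_exp_antisym by blast
  qed
  then show ?thesis by (simp add: min_gens_iff ugen_in_I)
qed

lemma pure_min_gen_eq_ugen:
  assumes m: "m \<in> min_gens I" "Poly_Mapping.keys m \<subseteq> {XVar i, YVar i}"
  shows "m = ugen i"
proof -
  have "divides_exp (ugen i) m"
    unfolding divides_exp_def
  proof
    fix v show "Poly_Mapping.lookup (ugen i) v \<le> Poly_Mapping.lookup m v"
      using single_factor_in_I_iff[OF m(2)] m(1) by (cases v) (auto simp: min_gens_iff)
  qed
  then show ?thesis using m ugen_in_I unfolding min_gens_iff by metis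
qed

lemma inj_ugen: "inj ugen"
proof (rule injI)
  fix i j assume e: "ugen i = ugen j"
  show "i = j"
  proof (rule ccontr)
    assume "i \<noteq> j"
    then have "xexp i = 0" "yexp i = 0"
      using lookup_ugen[of i i] lookup_ugen[of j i] e by auto
    then show False using ugen_nonzero[of i] by simp
  qed
qed

lemma min_gens_eq: "min_gens I = range ugen \<union> mixed_gens X"
proof
  show "min_gens I \<subseteq> range ugen \<union> mixed_gens X"
    using pure_min_gen_eq_ugen by (auto simp: mixed_gens_def)
  show "range ugen \<union> mixed_gens X \<subseteq> min_gens I"
    using ugen_min_gen by (auto simp: mixed_gens_def)
qed

lemma ugen_not_mixed: "range ugen \<inter> mixed_gens X = {}"
  using keys_ugen by (fastforce simp: mixed_gens_def)

definition vexp :: "'q hvar \<Rightarrow> nat" where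
  "vexp v = (case v of XVar i \<Rightarrow> xexp i | YVar i \<Rightarrow> yexp i)"

text \<open>Lowering an exponent of a monomial of \<open>I\<close> that exceeds \<open>vexp v\<close> down to \<open>vexp v\<close> keeps the monomial in
  \<open>I\<close>: on charts where \<open>v\<close> is a coordinate, its power \<open>vexp v\<close> alone lies in the chart ideal, and the
  other charts do not see \<open>v\<close>.\<close>

lemma min_gen_bounded:
  assumes g: "g \<in> min_gens I"
  shows "Poly_Mapping.lookup g v \<le> vexp v"
proof (rule ccontr)
  assume v: "\<not> ?thesis"
  define h where "h = Poly_Mapping.update v (vexp v) g"
  have "mon h \<in> I"
    unfolding mon_in_vanishing_ideal_iff[OF closed]
  proof
    fix A
    let ?r = "Poly_Mapping.map_key (chart_var A) :: ('q hvar \<Rightarrow>\<^sub>0 nat) \<Rightarrow> _"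
    show "mon (?r h) \<in> X A"
    proof (cases "v \<in> range (chart_var A)")
      case True
      then obtain i where i: "v = chart_var A i" by blast
      have "mon (Poly_Mapping.single i (vexp v)) \<in> X A"
        using x_pure_power_iff[of i "xexp i"] y_pure_power_iff[of i "yexp i"]
        by (auto simp: i chart_var_def vexp_def)
      then show ?thesis
        by (rule chart_mon_mono) (auto simp: h_def lookup_update lookup_single when_def i)
    next
      case False
      then have "?r h = ?r g"
        by (intro poly_mapping_eqI) (auto simp: h_def lookup_update)
      with g show ?thesis
        by (simp add: min_gens_iff mon_in_vanishing_ideal_iff[OF closed])
    qed
  qed
  moreover have "divides_exp h g"
    using v by (simp add: h_def divides_exp_def lookup_update)
  ultimately have "h = g" using g by (auto simp: min_gens_iff)
  then have "Poly_Mapping.lookup g v = vexp v"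
    by (metis h_def lookup_update)
  with v show False by simp
qed

lemma finite_min_gens: "finite (min_gens I)"
proof -
  have "Poly_Mapping.lookup ` min_gens I \<subseteq> (\<Pi>\<^sub>E v\<in>UNIV. {..vexp v})"
    using min_gen_bounded by auto
  then have "finite (Poly_Mapping.lookup ` min_gens I)"
    by (rule finite_subset) (intro finite_PiE; simp)
  then show ?thesis
    by (rule finite_imageD) (auto intro: inj_onI poly_mapping_eqI)
qed

text \<open>The exponents are bounded by those of \<open>ugen i\<close>, and cannot both attain the bound because \<open>ugen i\<close> does not
  divide another minimal generator.\<close>

lemma mixed_gen_degree_less:
  assumes g: "g \<in> mixed_gens X"
  shows "Poly_Mapping.lookup g (XVar i) + Poly_Mapping.lookup g (YVar i) < xexp i + yexp i"
proof -
  have gm: "g \<in> min_gens I" using g by (simp add: mixed_gens_def)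
  have bounds: "Poly_Mapping.lookup g (XVar i) \<le> xexp i" "Poly_Mapping.lookup g (YVar i) \<le> yexp i"
    using min_gen_bounded[OF gm, of "XVar i"] min_gen_bounded[OF gm, of "YVar i"] by (auto simp: vexp_def)
  have "\<not> divides_exp (ugen i) g"
    using gm g ugen_in_I ugen_not_mixed unfolding min_gens_iff by blast
  then obtain v where "Poly_Mapping.lookup g v < Poly_Mapping.lookup (ugen i) v"
    by (auto simp: divides_exp_def not_le)
  with bounds show ?thesis by (cases v) (auto split: if_splits)
qed

end


section \<open>The length of a monomial subscheme of the projective line\<close>

text \<open>The ideal generated by the \<open>e\<close>-th power of the coordinate on a chart of the projective
  line.\<close>

definition tpow :: "nat \<Rightarrow> (unit, 'k::field) mpoly set" where
  "tpow e = {f. \<forall>k\<in>Poly_Mapping.keys f. e \<le> Poly_Mapping.lookup k ()}"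

lemma tpow_mult_right:
  assumes "f \<in> tpow e"
  shows "g * f \<in> tpow e"
proof -
  have "e \<le> Poly_Mapping.lookup k ()" if k: "k \<in> Poly_Mapping.keys (g * f)" for k
  proof -
    obtain a b where "k = a + b" "b \<in> Poly_Mapping.keys f"
      using k keys_mult[of g f] by blast
    with assms show ?thesis by (auto simp: tpow_def lookup_add trans_le_add2)
  qed
  then show ?thesis by (simp add: tpow_def)
qed

lemma subspace_tpow: "ideal.subspace (tpow e :: (unit, 'k::field) mpoly set)"
proof (rule ideal.subspaceI)
  fix f g :: "(unit, 'k) mpoly"
  assume "f \<in> tpow e" "g \<in> tpow e"
  then show "f + g \<in> tpow e"
    unfolding tpow_def using Poly_Mapping.keys_add[of f g] by blast
qed (auto simp: tpow_mult_right, simp add: tpow_def)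

lemma mon_in_tpow_iff: "Poly_Mapping.single (Poly_Mapping.single () a) c \<in> tpow e \<longleftrightarrow> c = 0 \<or> e \<le> a"
  by (simp add: tpow_def)

lemma tpow_subset_iff: "(tpow a :: (unit, 'k::field) mpoly set) \<subseteq> tpow b \<longleftrightarrow> b \<le> a"
proof
  assume "(tpow a :: (unit, 'k) mpoly set) \<subseteq> tpow b"
  moreover have "(mon (Poly_Mapping.single () a) :: (unit, 'k) mpoly) \<in> tpow a"
    by (simp add: mon_in_tpow_iff)
  ultimately show "b \<le> a"
    by (metis mon_in_tpow_iff subsetD zero_neq_one)
qed (auto simp: tpow_def)

lemma tpow_inject: "(tpow a :: (unit, 'k::field) mpoly set) = tpow b \<longleftrightarrow> a = b"
  by (auto simp: set_eq_subset tpow_subset_iff)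

lemma tpow_subset_ideal:
  fixes V :: "(unit, 'k::field) mpoly set"
  assumes V: "ideal.subspace V" and mon: "mon (Poly_Mapping.single () e) \<in> V"
  shows "tpow e \<subseteq> V"
proof
  fix f :: "(unit, 'k) mpoly" assume "f \<in> tpow e"
  then have "\<forall>k\<in>Poly_Mapping.keys f. divides_exp (Poly_Mapping.single () e) k"
    by (auto simp: tpow_def divides_exp_def)
  with ideal_mon_divides[OF V mon] show "f \<in> V"
    by (intro ideal_contains_if_keys[OF V]) blast
qed

lemma unit_exp_eq: "(k :: unit \<Rightarrow>\<^sub>0 nat) = Poly_Mapping.single () (Poly_Mapping.lookup k ())"
  by (rule poly_mapping_eqI) simp

text \<open>Locally at the origin of a chart, the line has a discrete valuation ring as its coordinate ring; so the
  ideals that contain a power of the coordinate are generated by such powers. Here \<open>j\<close> is the least exponent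
  with \<open>tpow j \<subseteq> V\<close>, and an element of \<open>V\<close> of lower order would give \<open>tpow (j - 1) \<subseteq> V\<close>.\<close>

lemma ideal_containing_tpow:
  fixes V :: "(unit, 'k::field) mpoly set"
  assumes V: "ideal.subspace V" and e: "tpow e \<subseteq> V"
  obtains j where "V = tpow j"
proof
  define j where "j = (LEAST j. tpow j \<subseteq> V)"
  have j: "tpow j \<subseteq> V" unfolding j_def by (rule LeastI[of _ e]) (rule e)
  have "f \<in> tpow j" if f: "f \<in> V" for f
  proof (rule ccontr)
    assume "f \<notin> tpow j"
    then obtain k0 where k0: "k0 \<in> Poly_Mapping.keys f" "Poly_Mapping.lookup k0 () < j"
      by (auto simp: tpow_def not_le)
    obtain k where k: "k \<in> Poly_Mapping.keys f"
      and least: "\<And>l. l \<in> Poly_Mapping.keys f \<Longrightarrow> Poly_Mapping.lookup k () \<le> Poly_Mapping.lookup l ()"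
      using ex_has_least_nat[of "\<lambda>k. k \<in> Poly_Mapping.keys f" k0 "\<lambda>k. Poly_Mapping.lookup k ()"] k0 by auto
    define i where "i = Poly_Mapping.lookup k ()"
    define c where "c = Poly_Mapping.lookup f k"
    have i: "i < j" using least[OF k0(1)] k0(2) by (simp add: i_def)
    have c: "c \<noteq> 0" using k by (simp add: c_def in_keys_iff)
    have k_eq: "k = Poly_Mapping.single () i" unfolding i_def by (rule unit_exp_eq)
    let ?s = "Poly_Mapping.single () (j - 1 - i)"
    \<comment> \<open>After multiplication by a power of \<open>t\<close> the lowest term of \<open>f\<close> is of order \<open>j - 1\<close>,
      and all others lie in \<open>tpow j\<close>.\<close>
    have "mon ?s * (f - Poly_Mapping.single k c) \<in> tpow j"
    proof -
      have "j \<le> Poly_Mapping.lookup m ()"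
        if m: "m \<in> Poly_Mapping.keys (mon ?s * (f - Poly_Mapping.single k c))" for m
      proof -
        obtain l where l: "m = ?s + l" "l \<in> Poly_Mapping.keys (f - Poly_Mapping.single k c)"
          using m keys_mult[of "mon ?s" "f - Poly_Mapping.single k c"] by force
        then have "l \<noteq> k" "l \<in> Poly_Mapping.keys f"
          by (auto simp: in_keys_iff lookup_minus lookup_single when_def c_def split: if_splits)
        moreover from \<open>l \<noteq> k\<close> have "Poly_Mapping.lookup l () \<noteq> i"
          using unit_exp_eq[of l] k_eq by metis
        ultimately have "i < Poly_Mapping.lookup l ()"
          using least[of l] by (simp add: i_def)
        then show ?thesis using i by (simp add: l lookup_add)
      qed
      then show ?thesis by (simp add: tpow_def)
    qed
    then have "mon ?s * (f - Poly_Mapping.single k c) \<in> V" using j by blast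
    moreover have "mon ?s * f \<in> V" using ideal.subspace_scale[OF V] f by blast
    ultimately have "mon ?s * f - mon ?s * (f - Poly_Mapping.single k c) \<in> V"
      by (rule ideal.subspace_diff[OF V, rotated])
    then have "mon ?s * Poly_Mapping.single k c \<in> V"
      by (simp add: right_diff_distrib)
    then have "Poly_Mapping.single 0 (inverse c) * (mon ?s * Poly_Mapping.single k c) \<in> V"
      using ideal.subspace_scale[OF V] by blast
    then have "mon (Poly_Mapping.single () (j - 1)) \<in> V"
      using c i by (simp add: mult_single k_eq flip: single_add)
    then have "tpow (j - 1) \<subseteq> V" by (rule tpow_subset_ideal[OF V])
    then have "j \<le> j - 1" unfolding j_def by (rule Least_le)
    with i show False by simp
  qed
  with j show "V = tpow j" by blast
qed

definition monomial_points_line :: "nat \<Rightarrow> nat \<Rightarrow> (unit, 'k::field) chart_ideals" where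
  "monomial_points_line a b A = tpow (if () \<in> A then b else a)"

lemma closed_monomial_points_line:
  "closed_subscheme (monomial_points_line a b :: (unit, 'k::field) chart_ideals)"
  unfolding closed_subscheme_def
proof (intro conjI allI ballI impI)
  show "ideal.subspace (monomial_points_line a b A :: (unit, 'k) mpoly set)" for A
    by (simp add: monomial_points_line_def subspace_tpow)
  fix A B c F
  assume F: "dehom A F \<in> (monomial_points_line a b A :: (unit, 'k) mpoly set)"
  let ?e = "if () \<in> B then b else a"
  show "\<exists>N. (\<Prod>i\<in>A - B \<union> (B - A). coord i) ^ N * dehom B F \<in> monomial_points_line a b B"
  proof (cases "A = B")
    case True
    with F show ?thesis by (intro exI[of _ 0]) simp
  next
    case False
    then have "() \<in> A - B \<union> (B - A)" by auto
    then have "(\<Prod>i\<in>A - B \<union> (B - A). coord i :: (unit, 'k) mpoly) ^ ?e \<in> tpow ?e"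
      by (simp add: coord_power_prod tpow_def)
    then have "(\<Prod>i\<in>A - B \<union> (B - A). coord i) ^ ?e * dehom B F \<in> tpow ?e"
      using tpow_mult_right by (metis mult.commute)
    then show ?thesis unfolding monomial_points_line_def by blast
  qed
qed

text \<open>All chart ideals in a chain starting at this subscheme are powers of the coordinate. Each
  step lowers the sum of the two exponents by at least one, and a chain that lowers first \<open>a\<close> and then \<open>b\<close> one by one
  shows that the bound is attained.\<close>

lemma scheme_length_monomial_points_line:
  "scheme_length (monomial_points_line a b :: (unit, 'k::field) chart_ideals) = a + b"
proof -
  let ?Z = "monomial_points_line a b :: (unit, 'k) chart_ideals"
  let ?chain = "\<lambda>n C. C 0 = ?Z \<and> (\<forall>k\<le>n. closed_subscheme (C k)) \<and> (\<forall>k<n. C k < C (Suc k))"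
  have bound: "n \<le> a + b" if C: "?chain n C" for n C
  proof -
    have "C 0 A \<subseteq> C k A" if "k \<le> n" for k A
      using that
    proof (induction k)
      case (Suc k)
      then have "C k \<le> C (Suc k)" using C by (simp add: less_imp_le)
      then have "C k A \<subseteq> C (Suc k) A" by (simp add: le_fun_def)
      with Suc show ?case by auto
    qed simp
    then have "\<exists>j. C k A = tpow j" if "k \<le> n" for k A
      using that C ideal_containing_tpow[of "C k A"]
      unfolding closed_subscheme_def monomial_points_line_def by metis
    then obtain j where j: "\<And>k A. k \<le> n \<Longrightarrow> C k A = tpow (j k A)"
      by metis
    have sets: "A = {} \<or> A = {()}" for A :: "unit set"
      by auto
    have "k + (j k {} + j k {()}) \<le> a + b" if "k \<le> n" for k
      using that
    proof (induction k)
      case 0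
      have "C 0 {} = tpow a" "C 0 {()} = tpow b"
        using C by (simp_all add: monomial_points_line_def)
      then have "j 0 {} = a" "j 0 {()} = b"
        using j[of 0] by (simp_all add: tpow_inject)
      then show ?case by simp
    next
      case (Suc k)
      then have less: "C k < C (Suc k)" using C by simp
      have le: "j (Suc k) A \<le> j k A" for A
      proof -
        have "C k A \<subseteq> C (Suc k) A"
          using less_imp_le[OF less] by (simp add: le_fun_def)
        then show ?thesis using Suc.prems by (simp add: j tpow_subset_iff)
      qed
      have "j (Suc k) \<noteq> j k"
        using less Suc.prems j by (metis Suc_leD ext less_irrefl)
      then have "j (Suc k) {} \<noteq> j k {} \<or> j (Suc k) {()} \<noteq> j k {()}"
      proof (rule contrapos_np)
        assume "\<not> (j (Suc k) {} \<noteq> j k {} \<or> j (Suc k) {()} \<noteq> j k {()})"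
        then have "j (Suc k) A = j k A" for A using sets[of A] by auto
        then show "j (Suc k) = j k" by (rule ext)
      qed
      then have "Suc (j (Suc k) {} + j (Suc k) {()}) \<le> j k {} + j k {()}"
        using le[of "{}"] le[of "{()}"] by linarith
      with Suc show ?case by simp
    qed
    then show ?thesis by fastforce
  qed
  have "?chain (a + b) (\<lambda>k. monomial_points_line (a - k) (b - (k - a)))"
  proof (intro conjI allI impI)
    fix k assume k: "k < a + b"
    let ?C = "\<lambda>k. monomial_points_line (a - k) (b - (k - a)) :: (unit, 'k) chart_ideals"
    have "?C k \<le> ?C (Suc k)"
      by (auto simp: le_fun_def monomial_points_line_def tpow_subset_iff)
    moreover have "\<not> ?C (Suc k) \<le> ?C k"
    proof
      assume "?C (Suc k) \<le> ?C k"
      then have "?C (Suc k) {} \<subseteq> ?C k {}" "?C (Suc k) {()} \<subseteq> ?C k {()}"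
        by (auto simp: le_fun_def)
      then have "a - k \<le> a - Suc k" "b - (k - a) \<le> b - (Suc k - a)"
        by (simp_all add: monomial_points_line_def tpow_subset_iff)
      with k show False by linarith
    qed
    ultimately show "?C k < ?C (Suc k)" by (simp add: less_le_not_le)
  qed (simp_all add: closed_monomial_points_line)
  then have "a + b \<in> {n. \<exists>C. ?chain n C}"
    by (intro CollectI) (rule exI)
  with bound show ?thesis
    unfolding scheme_length_def by (intro cSup_eq_maximum) auto
qed

context monomial_points
begin

text \<open>By \<open>single_factor_in_I_iff\<close>, the ideal cut out in the ring of the factor \<open>i\<close> is generated by a
  monomial with exponents \<open>xexp i\<close> and \<open>yexp i\<close>; dehomogenizing leaves one of these exponents
  on each chart.\<close>

lemma projection_eq: "projection i X = monomial_points_line (xexp i) (yexp i)"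
proof
  fix A :: "unit set"
  define r where "r m = push_keys (map_hvar (\<lambda>_. i)) m" for m :: "unit hvar \<Rightarrow>\<^sub>0 nat"
  have inj: "inj (map_hvar (\<lambda>_::unit. i))"
    by (rule hvar.inj_map) (simp add: inj_def)
  have r: "Poly_Mapping.lookup (r m) (XVar i) = Poly_Mapping.lookup m (XVar ())"
    "Poly_Mapping.lookup (r m) (YVar i) = Poly_Mapping.lookup m (YVar ())" for m
    using lookup_push_keys_inj[OF inj, of m "XVar ()"] lookup_push_keys_inj[OF inj, of m "YVar ()"]
    by (simp_all add: r_def)
  have inj_r: "inj r"
  proof (rule injI, rule poly_mapping_eqI)
    fix m n v assume "r m = r n"
    then show "Poly_Mapping.lookup m v = Poly_Mapping.lookup n v"
      using r[of m] r[of n] by (cases v) auto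
  qed
  have "Poly_Mapping.keys (r m) \<subseteq> {XVar i, YVar i}" for m
  proof
    fix v assume "v \<in> Poly_Mapping.keys (r m)"
    then have "v \<in> range (map_hvar (\<lambda>_::unit. i))"
      using keys_push_keys[of "map_hvar (\<lambda>_. i)" m] by (auto simp: r_def)
    then show "v \<in> {XVar i, YVar i}" by (auto split: hvar.splits) (metis hvar.exhaust hvar.map)
  qed
  then have rI: "mon (r m) \<in> I \<longleftrightarrow>
      xexp i \<le> Poly_Mapping.lookup m (XVar ()) \<and> yexp i \<le> Poly_Mapping.lookup m (YVar ())" for m
    using single_factor_in_I_iff[of "r m" i] by (simp add: r)
  define W where "W = embed_factor i -` I"
  have W: "f \<in> W \<longleftrightarrow> (\<forall>m\<in>Poly_Mapping.keys f.
      xexp i \<le> Poly_Mapping.lookup m (XVar ()) \<and> yexp i \<le> Poly_Mapping.lookup m (YVar ()))" for f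
  proof -
    have "embed_factor i f = push_keys r f"
      by (simp add: embed_factor_def r_def[abs_def])
    then show ?thesis
      by (simp add: W_def support_closed_iff[OF supp, of "push_keys r f"] keys_push_keys_inj[OF inj_r] rI)
  qed
  let ?e = "if () \<in> A then yexp i else xexp i" and ?d = "if () \<in> A then xexp i else yexp i"
  have "dehom A ` W = tpow ?e"
  proof
    show "dehom A ` W \<subseteq> tpow ?e"
    proof
      fix p assume "p \<in> dehom A ` W"
      then obtain f where f: "f \<in> W" "p = dehom A f" by blast
      then show "p \<in> tpow ?e"
        using keys_push_keys[of "Poly_Mapping.map_key (chart_var A)" f]
        by (fastforce simp: tpow_def W dehom_def chart_var_def)
    qed
    show "tpow ?e \<subseteq> dehom A ` W"
    proof
      fix p :: "(unit, 'k) mpoly" assume p: "p \<in> tpow ?e"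
      define h where "h k = Poly_Mapping.single (chart_var A ()) (Poly_Mapping.lookup k ())
          + Poly_Mapping.single (chart_var (- A) ()) ?d" for k :: "unit \<Rightarrow>\<^sub>0 nat"
      have "dehom A (push_keys h p) = p"
        unfolding dehom_def push_keys_compose
        by (rule push_keys_ident, rule poly_mapping_eqI)
          (auto simp: h_def lookup_add lookup_single when_def chart_var_def)
      moreover have "push_keys h p \<in> W"
        using keys_push_keys[of h p] p
        by (fastforce simp: W h_def lookup_add lookup_single when_def chart_var_def tpow_def
            split: if_splits)
      ultimately show "p \<in> dehom A ` W" by (metis imageI)
    qed
  qed
  then show "projection i X A = monomial_points_line (xexp i) (yexp i) A"
    by (simp add: projection_def subscheme_of_def W_def monomial_points_line_def)
qed

lemma rho_nth: "rho X $ i = int (xexp i + yexp i) - 1"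
  by (simp add: rho_def projection_eq scheme_length_monomial_points_line)

end


section \<open>The Hilbert function counts standard monomials\<close>

lemma lookup_scale: "Poly_Mapping.lookup (scale c p) k = c * Poly_Mapping.lookup p k"
  unfolding scale_def mult_map_scale_conv_mult[symmetric]
  by (simp add: map.rep_eq when_def)

lemma mon_inject: "(mon l :: ('v, 'k::field) mpoly) = mon m \<Longrightarrow> l = m"
  by (metis keys_single one_neq_zero singleton_inject)

text \<open>The normal form modulo a monomial ideal: the terms of a polynomial that lie outside \<open>I\<close>.\<close>

definition standard_part :: "('v, 'k::field) mpoly set \<Rightarrow> ('v, 'k) mpoly \<Rightarrow> ('v, 'k) mpoly" where
  "standard_part I = Poly_Mapping.mapp (\<lambda>m c. if mon m \<in> I then 0 else c)"

lemma lookup_standard_part: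
  "Poly_Mapping.lookup (standard_part I p) m = (if mon m \<in> I then 0 else Poly_Mapping.lookup p m)"
  by (simp add: standard_part_def lookup_mapp when_def in_keys_iff)

lemma linear_standard_part:
  fixes I :: "('v, 'k::field) mpoly set"
  shows "Vector_Spaces.linear scale scale (standard_part I)"
proof unfold_locales
  fix p q :: "('v, 'k) mpoly" and c :: 'k
  show "standard_part I (p + q) = standard_part I p + standard_part I q"
    by (rule poly_mapping_eqI) (simp add: lookup_standard_part lookup_add)
  show "standard_part I (scale c p) = scale c (standard_part I p)"
    by (rule poly_mapping_eqI) (simp add: lookup_standard_part lookup_scale)
qed

lemma standard_part_eq_0_iff:
  assumes "support_closed I"
  shows "standard_part I p = 0 \<longleftrightarrow> p \<in> I"
  unfolding support_closed_iff[OF assms, of p] poly_mapping_eq_iff fun_eq_iff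
  by (auto simp: lookup_standard_part in_keys_iff)

lemma subspace_forms: "mpoly.subspace (forms a :: ('q::finite hvar, 'k::field) mpoly set)"
proof (rule mpoly.subspaceI)
  fix p q :: "('q hvar, 'k) mpoly" and c :: 'k
  assume p: "p \<in> forms a"
  show "scale c p \<in> forms a"
    using p by (auto simp: forms_def in_keys_iff lookup_scale)
  assume q: "q \<in> forms a"
  show "p + q \<in> forms a"
    using p q Poly_Mapping.keys_add[of p q] unfolding forms_def by blast
qed (simp add: forms_def)

text \<open>Taking normal forms is linear with kernel \<open>I\<close>. So it identifies the image of \<open>V\<close> in the quotient
  by \<open>I\<close> with a space of polynomials, and a basis modulo \<open>I\<close> with a basis of that space in the ordinary sense.\<close>

lemma basis_modulo_image:
  fixes I :: "('v, 'k::field) mpoly set"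
  assumes I: "support_closed I" and V: "mpoly.subspace V" and B: "basis_modulo I V B"
  shows "mpoly.independent (standard_part I ` B)"
    and "mpoly.span (standard_part I ` B) = standard_part I ` V"
    and "inj_on (standard_part I) B"
proof -
  interpret nf: Vector_Spaces.linear scale scale "standard_part I" by (rule linear_standard_part)
  have BV: "B \<subseteq> V" and repr: "\<And>v. v \<in> V \<Longrightarrow> \<exists>b\<in>mpoly.span B. v - b \<in> I"
    using B by (simp_all add: basis_modulo_def)
  have indep: "c b = 0"
    if "finite T" "T \<subseteq> B" "(\<Sum>b\<in>T. scale (c b) b) \<in> I" "b \<in> T" for T c b
  proof -
    have "\<forall>T c. finite T \<and> T \<subseteq> B \<and> (\<Sum>b\<in>T. scale (c b) b) \<in> I \<longrightarrow> (\<forall>b\<in>T. c b = 0)"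
      using B unfolding basis_modulo_def by (elim conjE)
    from this[rule_format, of T c b] that show ?thesis by blast
  qed
  show inj: "inj_on (standard_part I) B"
  proof (rule inj_onI, rule ccontr)
    fix b b' assume b: "b \<in> B" "b' \<in> B" "standard_part I b = standard_part I b'" "b \<noteq> b'"
    then have "standard_part I (b - b') = 0" by (simp only: nf.diff diff_self)
    then have "b - b' \<in> I" by (simp only: standard_part_eq_0_iff[OF I])
    then have "(\<Sum>x\<in>{b, b'}. scale (if x = b then 1 else - 1) x) \<in> I"
      using b(4) by (simp add: mpoly.scale_minus_left)
    then have "(if b = b then 1 else - 1 :: 'k) = 0"
      by (rule indep[rotated 2]) (use b in auto)
    then show False by simp
  qed
  show "mpoly.independent (standard_part I ` B)"
    unfolding mpoly.independent_explicit_module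
  proof (intro allI impI)
    fix t u v
    assume t: "finite t" "t \<subseteq> standard_part I ` B" "(\<Sum>v\<in>t. scale (u v) v) = 0" "v \<in> t"
    then obtain T where T: "T \<subseteq> B" "finite T" "t = standard_part I ` T"
      by (meson finite_subset_image)
    have "standard_part I (\<Sum>b\<in>T. scale (u (standard_part I b)) b) = (\<Sum>v\<in>t. scale (u v) v)"
      using inj_on_subset[OF inj T(1)] by (simp add: nf.sum nf.scale T(3) sum.reindex)
    then have "(\<Sum>b\<in>T. scale (u (standard_part I b)) b) \<in> I"
      using t(3) standard_part_eq_0_iff[OF I] by metis
    then have "u (standard_part I b) = 0" if "b \<in> T" for b
      using indep[OF T(2,1), of "\<lambda>b. u (standard_part I b)"] that by blast
    with t(4) T(3) show "u v = 0" by blast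
  qed
  show "mpoly.span (standard_part I ` B) = standard_part I ` V"
    unfolding nf.span_image
  proof
    show "standard_part I ` mpoly.span B \<subseteq> standard_part I ` V"
      using mpoly.span_minimal[OF BV V] by blast
    show "standard_part I ` V \<subseteq> standard_part I ` mpoly.span B"
    proof
      fix w assume "w \<in> standard_part I ` V"
      then obtain v where v: "v \<in> V" "w = standard_part I v" by blast
      then obtain b where "b \<in> mpoly.span B" "v - b \<in> I" using repr by blast
      then show "w \<in> standard_part I ` mpoly.span B"
        using v standard_part_eq_0_iff[OF I, of "v - b"] by (metis nf.diff right_minus_eq imageI)
    qed
  qed
qed

lemma card_basis_modulo_unique:
  assumes I: "support_closed I" and V: "mpoly.subspace V" and B: "basis_modulo I V B" "basis_modulo I V C"
  shows "card B = card C"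
proof -
  obtain f where "bij_betw f (standard_part I ` B) (standard_part I ` C)"
    using mpoly.bij_if_span_eq_span_bases basis_modulo_image[OF I V B(1)] basis_modulo_image[OF I V B(2)]
    by metis
  then have "card (standard_part I ` B) = card (standard_part I ` C)"
    by (rule bij_betw_same_card)
  then show ?thesis
    using basis_modulo_image(3)[OF I V] B by (simp add: card_image)
qed

lemma basis_modulo_standard_monomials:
  fixes I :: "('q::finite hvar, 'k::field) mpoly set"
  assumes I: "support_closed I"
  shows "basis_modulo I (forms a) (mon ` {m. mdeg m = a \<and> mon m \<notin> I})"
  unfolding basis_modulo_def
proof (intro conjI ballI allI impI)
  let ?S = "{m. mdeg m = a \<and> (mon m :: ('q hvar, 'k) mpoly) \<notin> I}"
  interpret nf: Vector_Spaces.linear scale scale "standard_part I" by (rule linear_standard_part)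
  show "mon ` ?S \<subseteq> forms a" by (auto simp: forms_def)
  fix v :: "('q hvar, 'k) mpoly"
  assume v: "v \<in> forms a"
  let ?n = "standard_part I v"
  have "scale (Poly_Mapping.lookup ?n m) (mon m) \<in> mpoly.span (mon ` ?S)"
    if m: "m \<in> Poly_Mapping.keys ?n" for m
  proof -
    have "m \<in> ?S"
      using m v by (auto simp: in_keys_iff lookup_standard_part forms_def split: if_splits)
    then show ?thesis by (intro mpoly.span_scale mpoly.span_base imageI)
  qed
  then have "(\<Sum>m\<in>Poly_Mapping.keys ?n. scale (Poly_Mapping.lookup ?n m) (mon m)) \<in> mpoly.span (mon ` ?S)"
    by (rule mpoly.span_sum)
  moreover have "(\<Sum>m\<in>Poly_Mapping.keys ?n. scale (Poly_Mapping.lookup ?n m) (mon m)) = ?n"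
    using poly_eq_sum_single[of "Poly_Mapping.keys ?n" ?n] by (simp add: scale_def mult_single)
  ultimately have span: "?n \<in> mpoly.span (mon ` ?S)" by (simp only:)
  have "v - ?n \<in> I"
    unfolding support_closed_iff[OF I, of "v - ?n"]
  proof
    fix m assume "m \<in> Poly_Mapping.keys (v - ?n)"
    then have "Poly_Mapping.lookup v m \<noteq> Poly_Mapping.lookup ?n m"
      by (simp add: in_keys_iff lookup_minus)
    then show "mon m \<in> I" by (metis lookup_standard_part)
  qed
  with span show "\<exists>b\<in>mpoly.span (mon ` ?S). v - b \<in> I" by (rule bexI[rotated])
next
  let ?S = "{m. mdeg m = a \<and> (mon m :: ('q hvar, 'k) mpoly) \<notin> I}"
  fix T c b
  assume T: "finite T \<and> T \<subseteq> mon ` ?S \<and> (\<Sum>b\<in>T. scale (c b) b) \<in> I" and b: "b \<in> T"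
  then obtain m where m: "m \<in> ?S" "b = mon m" by blast
  have "Poly_Mapping.lookup (scale (c x) x) m = (if x = b then c b else 0)" if x: "x \<in> T" for x
  proof -
    obtain l where "x = mon l" using x T by blast
    then show ?thesis by (auto simp: m(2) lookup_scale lookup_single when_def dest: mon_inject)
  qed
  then have "Poly_Mapping.lookup (\<Sum>b\<in>T. scale (c b) b) m = c b"
    using T b by (simp add: lookup_sum)
  then show "c b = 0"
    using T m support_closed_iff[OF I, of "\<Sum>b\<in>T. scale (c b) b"] by (auto simp: in_keys_iff)
qed

lemma dim_modulo_forms:
  fixes I :: "('q::finite hvar, 'k::field) mpoly set"
  assumes I: "support_closed I"
  shows "dim_modulo I (forms a) = card {m. mdeg m = a \<and> mon m \<notin> I}"
proof -
  let ?S = "{m. mdeg m = a \<and> (mon m :: ('q hvar, 'k) mpoly) \<notin> I}"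
  have basis: "basis_modulo I (forms a) (mon ` ?S)"
    by (rule basis_modulo_standard_monomials[OF I])
  then have "basis_modulo I (forms a) (SOME B. basis_modulo I (forms a) B)"
    by (rule someI)
  then have "dim_modulo I (forms a) = card ((mon :: _ \<Rightarrow> ('q hvar, 'k) mpoly) ` ?S)"
    unfolding dim_modulo_def by (rule card_basis_modulo_unique[OF I subspace_forms _ basis])
  also have "\<dots> = card ?S"
    by (rule card_image) (auto intro!: inj_onI dest: mon_inject)
  finally show ?thesis .
qed


section \<open>Counting monomials of a given degree\<close>

text \<open>A monomial of degree \<open>a\<close> is determined by its exponents at the variables \<open>XVar i\<close>, which range over
  independent intervals. An empty interval gives a factor 0 through \<open>nat\<close>.\<close>

lemma card_monomials_above:
  fixes a :: "int ^ 'q::finite" and l :: "'q hvar \<Rightarrow> nat"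
  shows "card {m. mdeg m = a \<and> (\<forall>v. l v \<le> Poly_Mapping.lookup m v)}
    = (\<Prod>i\<in>UNIV. nat (a $ i - int (l (XVar i) + l (YVar i)) + 1))"
    (is "card ?M = _")
proof -
  let ?E = "\<Pi>\<^sub>E i\<in>UNIV. {l (XVar i) ..< l (XVar i) + nat (a $ i - int (l (XVar i) + l (YVar i)) + 1)}"
  define f where "f x = Abs_poly_mapping (\<lambda>v. case v of XVar i \<Rightarrow> x i | YVar i \<Rightarrow> nat (a $ i) - x i)"
    for x :: "'q \<Rightarrow> nat"
  define g where "g m i = Poly_Mapping.lookup m (XVar i)" for m :: "'q hvar \<Rightarrow>\<^sub>0 nat" and i
  have "bij_betw g ?M ?E"
  proof (rule bij_betw_byWitness[where f' = f])
    show "\<forall>m\<in>?M. f (g m) = m"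
      by (auto simp: f_def g_def mdeg_def intro!: poly_mapping_eqI split: hvar.split)
    show "\<forall>x\<in>?E. g (f x) = x"
      by (auto simp: f_def g_def fun_eq_iff)
    show "g ` ?M \<subseteq> ?E"
    proof (intro image_subsetI PiE_I)
      fix m i assume m: "m \<in> ?M"
      then have "l (XVar i) \<le> Poly_Mapping.lookup m (XVar i)" "l (YVar i) \<le> Poly_Mapping.lookup m (YVar i)"
        "a $ i = int (Poly_Mapping.lookup m (XVar i) + Poly_Mapping.lookup m (YVar i))"
        by (auto simp: mdeg_nth)
      then show "g m i \<in> {l (XVar i) ..< l (XVar i) + nat (a $ i - int (l (XVar i) + l (YVar i)) + 1)}"
        by (auto simp: g_def)
    qed simp
    show "f ` ?E \<subseteq> ?M"
    proof (rule image_subsetI)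
      fix x assume "x \<in> ?E"
      then have x: "l (XVar i) \<le> x i \<and> x i < l (XVar i) + nat (a $ i - int (l (XVar i) + l (YVar i)) + 1)" for i
        by (fastforce simp: PiE_iff)
      have b: "l (YVar i) \<le> nat (a $ i) - x i \<and> int (x i + (nat (a $ i) - x i)) = a $ i" for i
        using x[of i] by linarith
      show "f x \<in> ?M"
        using x b by (auto simp: f_def mdeg_nth vec_eq_iff split: hvar.split)
    qed
  qed
  then have "card ?M = card ?E" by (rule bij_betw_same_card)
  then show ?thesis by (simp add: card_PiE)
qed

lemma finite_monomials_of_degree: "finite {m. mdeg m = (a :: int ^ 'q::finite)}"
proof -
  have "Poly_Mapping.lookup ` {m. mdeg m = a} \<subseteq> (\<Pi>\<^sub>E v\<in>UNIV. {.. nat (case v of XVar i \<Rightarrow> a $ i | YVar i \<Rightarrow> a $ i)})"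
    by (auto simp: mdeg_nth split: hvar.split)
  then have "finite (Poly_Mapping.lookup ` {m. mdeg m = a})"
    by (rule finite_subset) (intro finite_PiE; simp)
  then show ?thesis
    by (rule finite_imageD) (rule inj_onI, rule poly_mapping_eqI, simp)
qed

text \<open>The function is a product of functions of one coordinate each, hence its difference function is the
  product of the one-variable differences, and the difference of \<open>n \<mapsto> max 0 (n + 1)\<close> is the indicator function of \<open>n \<ge> 0\<close>.\<close>

lemma Delta_box:
  fixes d :: "'q::finite \<Rightarrow> int"
  shows "Delta (\<lambda>a. \<Prod>i\<in>UNIV. int (nat (a $ i - d i + 1))) a = (if \<forall>i. d i \<le> a $ i then 1 else 0)"
proof -
  let ?f = "\<lambda>i. int (nat (a $ i - d i + 1))" and ?g = "\<lambda>i. int (nat (a $ i - d i))"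
  have nth: "(a - (\<Sum>i\<in>T. axis i 1)) $ j = a $ j - (if j \<in> T then 1 else 0)" for T j
    by (simp add: axis_def sum.If_cases Int_def)
  have shifted: "(\<Prod>i\<in>UNIV. int (nat ((a - (\<Sum>i\<in>T. axis i 1)) $ i - d i + 1)))
      = (\<Prod>i\<in>T. ?g i) * (\<Prod>i\<in>UNIV - T. ?f i)" for T
  proof -
    have "(\<Prod>i\<in>UNIV. int (nat ((a - (\<Sum>i\<in>T. axis i 1)) $ i - d i + 1)))
       = (\<Prod>i\<in>UNIV. if i \<in> T then ?g i else ?f i)"
      unfolding nth by (rule prod.cong) auto
    also have "\<dots> = (\<Prod>i\<in>T. ?g i) * (\<Prod>i\<in>UNIV - T. ?f i)"
      by (simp add: prod.If_cases Int_def Compl_eq_Diff_UNIV)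
    finally show ?thesis .
  qed
  have "Delta (\<lambda>a. \<Prod>i\<in>UNIV. int (nat (a $ i - d i + 1))) a
      = (\<Sum>T\<in>Pow UNIV. (- 1) ^ card T * ((\<Prod>i\<in>T. ?g i) * (\<Prod>i\<in>UNIV - T. ?f i)))"
    unfolding Delta_def by (simp only: shifted)
  also have "\<dots> = (\<Prod>i\<in>UNIV. ?f i - ?g i)"
    by (simp only: prod_diff_conv_sum[OF finite] mult.assoc)
  also have "\<dots> = (\<Prod>i\<in>UNIV. if d i \<le> a $ i then 1 else 0)"
    by (rule prod.cong) auto
  also have "\<dots> = (if \<forall>i. d i \<le> a $ i then 1 else 0)"
    by auto
  finally show ?thesis .
qed


section \<open>Inclusion and exclusion over the generators\<close>

text \<open>Inserting \<open>g\<close> into \<open>T\<close>, or removing it, is a sign-reversing involution.\<close>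

lemma alternating_sum_cancel:
  assumes G: "finite G" "g \<in> G" and P: "\<And>T. T \<subseteq> G - {g} \<Longrightarrow> P (insert g T) \<longleftrightarrow> P T"
  shows "(\<Sum>T\<in>Pow G. if P T then (- 1) ^ card T else 0) = (0::int)"
proof -
  let ?H = "G - {g}" and ?f = "\<lambda>T. if P T then (- 1) ^ card T else (0::int)"
  have "Pow G = Pow ?H \<union> insert g ` Pow ?H"
    using G(2) Pow_insert[of g ?H] by (simp add: insert_absorb)
  then have "(\<Sum>T\<in>Pow G. ?f T) = (\<Sum>T\<in>Pow ?H. ?f T) + (\<Sum>T\<in>insert g ` Pow ?H. ?f T)"
    using G(1) by (simp add: sum.union_disjoint) (subst sum.union_disjoint; auto)
  also have "(\<Sum>T\<in>insert g ` Pow ?H. ?f T) = (\<Sum>T\<in>Pow ?H. ?f (insert g T))"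
    by (rule sum.reindex_cong[of "insert g"]) (auto simp: inj_on_def)
  also have "\<dots> = (\<Sum>T\<in>Pow ?H. - ?f T)"
  proof (rule sum.cong)
    fix T assume T: "T \<in> Pow ?H"
    then have "finite T" "g \<notin> T" using G(1) by (auto intro: finite_subset)
    then show "?f (insert g T) = - ?f T" using P[of T] T by simp
  qed simp
  finally show ?thesis by (simp add: sum_negf)
qed

lemma alternating_sum_Pow:
  assumes "finite G"
  shows "(\<Sum>T\<in>Pow G. (- 1) ^ card T) = (if G = {} then 1 else (0::int))"
proof (cases "G = {}")
  case False
  then obtain g where "g \<in> G" by blast
  from alternating_sum_cancel[OF assms this, of "\<lambda>_. True"] False show ?thesis by simp
qed simp

definition lcm_exponents :: "('v \<Rightarrow>\<^sub>0 nat) set \<Rightarrow> 'v \<Rightarrow> nat" where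
  "lcm_exponents T v = Max (insert 0 ((\<lambda>g. Poly_Mapping.lookup g v) ` T))"

lemma lcm_exponents_le_iff:
  "finite T \<Longrightarrow> lcm_exponents T v \<le> n \<longleftrightarrow> (\<forall>g\<in>T. Poly_Mapping.lookup g v \<le> n)"
  by (simp add: lcm_exponents_def)

lemma lcm_exponents_insert:
  "finite T \<Longrightarrow> lcm_exponents (insert g T) v = max (Poly_Mapping.lookup g v) (lcm_exponents T v)"
  by (simp add: lcm_exponents_def insert_commute[of 0])

lemma lcm_exponents_attained:
  assumes "finite T" "0 < lcm_exponents T v"
  obtains h where "h \<in> T" "Poly_Mapping.lookup h v = lcm_exponents T v"
  using assms Max_in[of "insert 0 ((\<lambda>g. Poly_Mapping.lookup g v) ` T)"]
  by (auto simp: lcm_exponents_def)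

definition lcm_degree_le :: "('q hvar \<Rightarrow>\<^sub>0 nat) set \<Rightarrow> int ^ 'q \<Rightarrow> bool" where
  "lcm_degree_le T a \<longleftrightarrow> (\<forall>i. int (lcm_exponents T (XVar i) + lcm_exponents T (YVar i)) \<le> a $ i)"

lemma lcm_degree_le_insertD:
  assumes "finite T" "lcm_degree_le (insert g T) a"
  shows "lcm_degree_le T a"
proof -
  have "int (lcm_exponents T (XVar i) + lcm_exponents T (YVar i))
      \<le> int (lcm_exponents (insert g T) (XVar i) + lcm_exponents (insert g T) (YVar i))" for i
    using assms(1) by (simp add: lcm_exponents_insert)
  with assms(2) show ?thesis
    unfolding lcm_degree_le_def using order_trans by blast
qed

context monomial_points
begin

lemma hilbert_function_eq_card: "hilbert_function X a = int (card {m. mdeg m = a \<and> mon m \<notin> I})"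
  by (simp add: hilbert_function_def dim_modulo_forms[OF supp])

text \<open>The Euler characteristic of the Taylor complex of \<open>I\<close> in degree \<open>a\<close>: the Hilbert function counts the monomials that no
  generator divides, and the monomials divisible by all elements of \<open>T\<close> are the multiples of their least common
  multiple.\<close>

lemma hilbert_function_inclusion_exclusion:
  "hilbert_function X a = (\<Sum>T\<in>Pow (min_gens I). (- 1) ^ card T *
     (\<Prod>i\<in>UNIV. int (nat (a $ i - int (lcm_exponents T (XVar i) + lcm_exponents T (YVar i)) + 1))))"
proof -
  let ?M = "{m. mdeg m = a}" and ?G = "min_gens I"
  let ?D = "\<lambda>m. {g \<in> ?G. divides_exp g m}"
  have fin: "finite ?M" by (rule finite_monomials_of_degree)
  have iff: "mon m \<notin> I \<longleftrightarrow> ?D m = {}" for m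
  proof
    assume "mon m \<notin> I"
    then have "\<not> divides_exp g m" if "g \<in> ?G" for g
      using that ideal_mon_divides[OF subspace_I] unfolding min_gens_iff by blast
    then show "?D m = {}" by blast
  next
    assume "?D m = {}"
    then show "mon m \<notin> I" using min_gen_divides[of m I] by blast
  qed
  have "hilbert_function X a = (\<Sum>m\<in>?M. if mon m \<notin> I then 1 else 0)"
    using fin by (simp add: hilbert_function_eq_card sum.If_cases Int_def)
  also have "\<dots> = (\<Sum>m\<in>?M. \<Sum>T\<in>Pow (?D m). (- 1) ^ card T)"
    by (intro sum.cong refl) (simp add: iff alternating_sum_Pow finite_min_gens)
  also have "\<dots> = (\<Sum>m\<in>?M. \<Sum>T\<in>Pow ?G. if \<forall>g\<in>T. divides_exp g m then (- 1) ^ card T else 0)"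
  proof (rule sum.cong[OF refl])
    fix m
    show "(\<Sum>T\<in>Pow (?D m). (- 1) ^ card T)
        = (\<Sum>T\<in>Pow ?G. if \<forall>g\<in>T. divides_exp g m then (- 1) ^ card T else (0::int))"
      by (rule sum.mono_neutral_cong_left) (auto simp: finite_min_gens)
  qed
  also have "\<dots> = (\<Sum>T\<in>Pow ?G. \<Sum>m\<in>?M. if \<forall>g\<in>T. divides_exp g m then (- 1) ^ card T else 0)"
    by (rule sum.swap)
  also have "\<dots> = (\<Sum>T\<in>Pow ?G. (- 1) ^ card T *
     (\<Prod>i\<in>UNIV. int (nat (a $ i - int (lcm_exponents T (XVar i) + lcm_exponents T (YVar i)) + 1))))"
  proof (rule sum.cong[OF refl])
    fix T assume "T \<in> Pow ?G"
    then have T: "finite T" using finite_min_gens by (auto intro: finite_subset)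
    have above: "(\<forall>g\<in>T. divides_exp g m) \<longleftrightarrow> (\<forall>v. lcm_exponents T v \<le> Poly_Mapping.lookup m v)" for m
      by (auto simp: lcm_exponents_le_iff[OF T] divides_exp_def)
    have "(\<Sum>m\<in>?M. if \<forall>g\<in>T. divides_exp g m then (- 1) ^ card T else 0)
        = (- 1) ^ card T * int (card {m. mdeg m = a \<and> (\<forall>v. lcm_exponents T v \<le> Poly_Mapping.lookup m v)})"
      using fin by (simp add: above sum.If_cases Int_def)
    then show "(\<Sum>m\<in>?M. if \<forall>g\<in>T. divides_exp g m then (- 1) ^ card T else 0) = (- 1) ^ card T *
     (\<Prod>i\<in>UNIV. int (nat (a $ i - int (lcm_exponents T (XVar i) + lcm_exponents T (YVar i)) + 1)))"
      by (simp only: card_monomials_above of_nat_prod)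
  qed
  finally show ?thesis .
qed

lemma Delta_hilbert_function:
  "Delta (hilbert_function X) a
    = (\<Sum>T\<in>Pow (min_gens I). if lcm_degree_le T a then (- 1) ^ card T else 0)"
proof -
  let ?h = "\<lambda>T a. \<Prod>i\<in>UNIV. int (nat (a $ i - int (lcm_exponents T (XVar i) + lcm_exponents T (YVar i)) + 1))"
  have "Delta (hilbert_function X) a
      = (\<Sum>S\<in>Pow UNIV. \<Sum>T\<in>Pow (min_gens I). (- 1) ^ card T * ((- 1) ^ card S * ?h T (a - (\<Sum>i\<in>S. axis i 1))))"
    unfolding Delta_def hilbert_function_inclusion_exclusion sum_distrib_left
    by (simp only: mult.left_commute)
  also have "\<dots> = (\<Sum>T\<in>Pow (min_gens I). (- 1) ^ card T * Delta (?h T) a)"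
    unfolding Delta_def sum_distrib_left by (rule sum.swap)
  also have "\<dots> = (\<Sum>T\<in>Pow (min_gens I). if lcm_degree_le T a then (- 1) ^ card T else 0)"
    unfolding Delta_box by (intro sum.cong refl) (simp add: lcm_degree_le_def)
  finally show ?thesis .
qed

end


section \<open>Vanishing of the difference function\<close>

lemma finite_int_vec_interval: "finite {a .. b :: int ^ 'q::finite}"
proof -
  have "vec_nth ` {a .. b} \<subseteq> (\<Pi>\<^sub>E i\<in>UNIV. {a $ i .. b $ i})"
    by (auto simp: less_eq_vec_def)
  then have "finite (vec_nth ` {a .. b})"
    by (rule finite_subset) (intro finite_PiE; simp)
  then show ?thesis
    by (rule finite_imageD) (auto intro: inj_onI simp: vec_eq_iff)
qed

lemma quasi_rectangular_lower_set:
  fixes S :: "(int ^ 'q::finite) set"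
  assumes S: "S \<subseteq> {0..r}" and down: "\<And>a b. a \<in> S \<Longrightarrow> 0 \<le> b \<Longrightarrow> b \<le> a \<Longrightarrow> b \<in> S"
  shows "quasi_rectangular S"
  unfolding quasi_rectangular_def
proof (intro exI[of _ S] conjI)
  show "finite S" using S finite_int_vec_interval by (rule finite_subset)
  show "\<forall>r\<in>S. 0 \<le> r" using S by auto
  then have "S \<subseteq> (\<Union>r\<in>S. {0..r})" by (intro subsetI UN_I) auto
  moreover have "(\<Union>r\<in>S. {0..r}) \<subseteq> S" using down by fastforce
  ultimately show "S = (\<Union>r\<in>S. {0..r})" by (rule subset_antisym)
qed

context monomial_points
begin

lemma Delta_eq_0_if_generator_insertable:
  assumes g: "g \<in> min_gens I"
    and ins: "\<And>T. T \<subseteq> min_gens I \<Longrightarrow> lcm_degree_le T a \<Longrightarrow> lcm_degree_le (insert g T) a"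
  shows "Delta (hilbert_function X) a = 0"
  unfolding Delta_hilbert_function
proof (rule alternating_sum_cancel[OF finite_min_gens g])
  fix T assume T: "T \<subseteq> min_gens I - {g}"
  then have "finite T" using finite_min_gens by (auto intro: finite_subset)
  then show "lcm_degree_le (insert g T) a \<longleftrightarrow> lcm_degree_le T a"
    using T ins lcm_degree_le_insertD by blast
qed

text \<open>In a negative degree no set of generators contributes. If \<open>a $ i\<close> is at least the length of the
  \<open>i\<close>-th projection, \<open>ugen i\<close> can be inserted: it changes only the \<open>i\<close>-th degree of the least common multiple,
  and by \<open>min_gen_bounded\<close> this degree never exceeds that of \<open>ugen i\<close>.\<close>

lemma Delta_eq_0_outside_R:
  assumes "a \<notin> R X"
  shows "Delta (hilbert_function X) a = 0"
proof -
  obtain i where "\<not> (0 \<le> a $ i \<and> a $ i \<le> rho X $ i)"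
    using assms by (auto simp: R_def less_eq_vec_def)
  then have "a $ i < 0 \<or> int (xexp i + yexp i) \<le> a $ i"
    unfolding rho_nth by linarith
  then show ?thesis
  proof
    assume "a $ i < 0"
    then have "\<not> lcm_degree_le T a" for T
      unfolding lcm_degree_le_def by (metis of_nat_0_le_iff leD order_trans)
    then show ?thesis by (simp add: Delta_hilbert_function)
  next
    assume i: "int (xexp i + yexp i) \<le> a $ i"
    show ?thesis
    proof (rule Delta_eq_0_if_generator_insertable[OF ugen_min_gen])
      fix T assume T: "T \<subseteq> min_gens I" "lcm_degree_le T a"
      then have fin: "finite T" using finite_min_gens by (auto intro: finite_subset)
      have bound: "lcm_exponents T (XVar i) \<le> xexp i" "lcm_exponents T (YVar i) \<le> yexp i"
        using T(1) min_gen_bounded[of _ "XVar i"] min_gen_bounded[of _ "YVar i"]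
        by (auto simp: lcm_exponents_le_iff[OF fin] vexp_def)
      show "lcm_degree_le (insert (ugen i) T) a"
        unfolding lcm_degree_le_def
      proof
        fix j
        show "int (lcm_exponents (insert (ugen i) T) (XVar j)
            + lcm_exponents (insert (ugen i) T) (YVar j)) \<le> a $ j"
          using T(2) i bound by (cases "i = j") (auto simp: lcm_exponents_insert[OF fin] lcm_degree_le_def)
      qed
    qed
  qed
qed

lemma finite_mixed_gens: "finite (mixed_gens X)"
  using finite_min_gens by (auto simp: mixed_gens_def intro: finite_subset[rotated])

text \<open>The generator \<open>g\<close> itself can be inserted. In each factor only two exponents matter, and each of
  them is attained in the least common multiple by a single generator. So the degree of the least common multiple of
  \<open>g\<close> and \<open>T\<close> in this factor is that of \<open>T\<close> or of \<open>g\<close>, or is bounded by that of the least common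
  multiple of \<open>g\<close> and one element of \<open>T\<close>. That element is a mixed generator, since
  the generators \<open>ugen i\<close> have degrees outside \<open>R X\<close>.\<close>

lemma Delta_eq_0_on_R_gen:
  assumes g: "g \<in> mixed_gens X" and a: "a \<in> R X" "a \<in> R_gen X g"
  shows "Delta (hilbert_function X) a = 0"
proof (rule Delta_eq_0_if_generator_insertable)
  show "g \<in> min_gens I" using g by (simp add: mixed_gens_def)
  have lookup_lcm: "Poly_Mapping.lookup (lcm_exp h k) v = max (Poly_Mapping.lookup h v) (Poly_Mapping.lookup k v)"
    for h k :: "'q hvar \<Rightarrow>\<^sub>0 nat" and v
    by (simp add: lcm_exp.rep_eq)
  have pair: "int (max (Poly_Mapping.lookup h (XVar i)) (Poly_Mapping.lookup g (XVar i))
      + max (Poly_Mapping.lookup h (YVar i)) (Poly_Mapping.lookup g (YVar i))) \<le> a $ i"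
    if h: "h \<in> mixed_gens X" "h \<noteq> g" for h i
  proof -
    have "card {h, g} \<le> card (mixed_gens X)"
      using h g finite_mixed_gens by (intro card_mono) auto
    then have "card (mixed_gens X) \<noteq> 1" using h by simp
    with a(2) h have "mdeg (lcm_exp h g) \<le> a" by (auto simp: R_gen_def)
    then show ?thesis by (simp add: less_eq_vec_def mdeg_nth lookup_lcm)
  qed
  have deg_g: "int (Poly_Mapping.lookup g (XVar i) + Poly_Mapping.lookup g (YVar i)) \<le> a $ i" for i
  proof (cases "card (mixed_gens X) = 1")
    case True
    with a(2) show ?thesis by (simp add: R_gen_def less_eq_vec_def mdeg_nth)
  next
    case False
    then have "mixed_gens X \<noteq> {g}" by auto
    then obtain h where "h \<in> mixed_gens X" "h \<noteq> g" using g by blast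
    from pair[OF this, of i] show ?thesis by linarith
  qed
  fix T assume T: "T \<subseteq> min_gens I" "lcm_degree_le T a"
  then have fin: "finite T" using finite_min_gens by (auto intro: finite_subset)
  have le: "Poly_Mapping.lookup h v \<le> lcm_exponents T v" if "h \<in> T" for h v
    using that lcm_exponents_le_iff[OF fin, of v "lcm_exponents T v"] by simp
  have mixed: "T \<subseteq> mixed_gens X"
  proof (rule ccontr)
    assume "\<not> ?thesis"
    then obtain h where h: "h \<in> T" "h \<notin> mixed_gens X" by blast
    with T(1) min_gens_eq have "h \<in> range ugen" by auto
    then obtain i where i: "ugen i \<in> T" using h(1) by auto
    have "a $ i \<le> int (xexp i + yexp i) - 1"
      using a(1) by (simp add: R_def less_eq_vec_def rho_nth flip: of_nat_add)
    moreover have "int (lcm_exponents T (XVar i) + lcm_exponents T (YVar i)) \<le> a $ i"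
      using T(2) by (simp add: lcm_degree_le_def)
    ultimately show False using le[OF i, of "XVar i"] le[OF i, of "YVar i"] by simp
  qed
  show "lcm_degree_le (insert g T) a"
    unfolding lcm_degree_le_def
  proof
    fix i
    let ?x = "lcm_exponents T (XVar i)" and ?y = "lcm_exponents T (YVar i)"
    let ?gx = "Poly_Mapping.lookup g (XVar i)" and ?gy = "Poly_Mapping.lookup g (YVar i)"
    have T': "int (?x + ?y) \<le> a $ i" using T(2) by (simp add: lcm_degree_le_def)
    have "int (?gx + ?y) \<le> a $ i" if y: "?gy < ?y"
    proof -
      obtain h where h: "h \<in> T" "Poly_Mapping.lookup h (YVar i) = ?y"
        using lcm_exponents_attained[OF fin, of "YVar i"] y by auto
      then have "h \<noteq> g" using y by auto
      with h mixed pair[of h i] show ?thesis by auto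
    qed
    moreover have "int (?x + ?gy) \<le> a $ i" if x: "?gx < ?x"
    proof -
      obtain h where h: "h \<in> T" "Poly_Mapping.lookup h (XVar i) = ?x"
        using lcm_exponents_attained[OF fin, of "XVar i"] x by auto
      then have "h \<noteq> g" using x by auto
      with h mixed pair[of h i] show ?thesis by auto
    qed
    ultimately have "int (max ?gx ?x + max ?gy ?y) \<le> a $ i"
      using T' deg_g[of i] by (cases "?gx < ?x"; cases "?gy < ?y") (auto simp: max_def)
    then show "int (lcm_exponents (insert g T) (XVar i) + lcm_exponents (insert g T) (YVar i)) \<le> a $ i"
      by (simp add: lcm_exponents_insert[OF fin])
  qed
qed

lemma hilbert_function_negative:
  assumes "\<not> 0 \<le> a"
  shows "hilbert_function X a = 0"
proof -
  have "mdeg m \<noteq> a" for m using assms by (auto simp: less_eq_vec_def mdeg_nth)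
  then show ?thesis by (simp add: hilbert_function_eq_card)
qed

lemma R_gen_upward: "b \<in> R_gen X g \<Longrightarrow> b \<le> a \<Longrightarrow> a \<le> rho X \<Longrightarrow> a \<in> R_gen X g"
  unfolding R_gen_def by (auto split: if_splits intro: order_trans)

lemma quasi_rectangular_D: "quasi_rectangular (D X)"
proof (rule quasi_rectangular_lower_set)
  show "D X \<subseteq> {0..rho X}" by (auto simp: D_def R_def)
  fix a b assume a: "a \<in> D X" and b: "0 \<le> b" "b \<le> a"
  then have "a \<le> rho X" by (simp add: D_def R_def)
  with a b show "b \<in> D X"
    using R_gen_upward[OF _ b(2)] by (auto simp: D_def R_def)
qed

lemma relevant_domain_D: "relevant_domain (hilbert_function X) (D X)"
  unfolding relevant_domain_def
proof (intro conjI allI impI)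
  fix a assume "a \<notin> D X"
  then show "Delta (hilbert_function X) a = 0"
    using Delta_eq_0_outside_R Delta_eq_0_on_R_gen by (auto simp: D_def)
qed (auto simp: quasi_rectangular_D hilbert_function_negative)

text \<open>The generators \<open>ugen i\<close> are as many as the factors, so there is exactly one mixed generator. Its
  degree is at most \<open>rho X\<close>; so \<open>rho X\<close> itself is removed from \<open>R X\<close>.\<close>

lemma D_strict_subset_R:
  assumes card: "card (min_gens I) = CARD('q) + 1"
  shows "D X \<subset> R X"
proof -
  have "card (min_gens I) = card (range ugen) + card (mixed_gens X)"
    unfolding min_gens_eq using ugen_not_mixed finite_mixed_gens by (intro card_Un_disjoint) auto
  then have one: "card (mixed_gens X) = 1"
    using card by (simp add: card_image inj_ugen)
  then obtain g where g: "mixed_gens X = {g}" by (auto simp: card_1_singleton_iff)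
  have "mdeg g \<le> rho X"
    unfolding less_eq_vec_def
  proof
    fix i
    show "mdeg g $ i \<le> rho X $ i"
      using mixed_gen_degree_less[of g i] g by (simp add: mdeg_nth rho_nth)
  qed
  then have "rho X \<in> R_gen X g" by (simp add: R_gen_def one)
  moreover have "rho X \<in> R X"
  proof -
    have "0 \<le> rho X $ i" for i using ugen_nonzero[of i] unfolding rho_nth by linarith
    then show ?thesis by (simp add: R_def less_eq_vec_def)
  qed
  ultimately show ?thesis using g by (auto simp: D_def)
qed

end

theorem proposition9p5:
  fixes X :: "('q::finite, 'k::field) chart_ideals"
  assumes "infinite (UNIV :: 'k set)"
    and "CARD('q) \<ge> 2"
    and "closed_subscheme X"
    and "zero_dimensional X"
    and "monomial_ideal (vanishing_ideal X)"
    and "\<not> complete_intersection X"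
  shows "relevant_domain (hilbert_function X) (D X)
    \<and> (card (min_gens (vanishing_ideal X)) = CARD('q) + 1 \<longrightarrow> D X \<subset> R X)"
proof -
  interpret monomial_points X
    using assms by unfold_locales
  show ?thesis using relevant_domain_D D_strict_subset_R by blast
qed

end
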